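(* **(A)** Any helicoidal $\mathcal{K}^{1/4}$-translator $\Sigma$ of pitch $\mu$ admits a one-parameter family of isometric helicoidal $\mathcal{K}^{1/4}$-translators $\Sigma^{h}$ with pitch $h$ such that $\Sigma=\Sigma^{\mu}$ and $\Sigma^{0}$ is rotational. **(B)** The cylinder over a circle in the $xy$-plane is a rotational $\mathcal{K}^{1/4}$-translator. Additionally, there exists a one-parameter family of $\mathcal{K}^{1/4}$-translators $\mathcal{H}_{c}$ invariant under the rotation about the $z$-axis. The profile curve of the rotational surface $\mathcal{H}_c$ is congruent to the graph $(U,0,\Lambda_c(U))$, where the one-parameter family of height functions $\Lambda_c(U)$ is explicitly given by $$ \Lambda_{c}(U)=\begin{cases} \frac12\left[\,U\sqrt{U^2+\kappa^2}+\kappa^2\,\mathrm{arcsinh}\left(\frac{U}{\kappa}\right)\right], & U>0 \quad (\text{when } c=1+\kappa^2,\ \kappa>0),\\[1mm] \frac12\,U^2, & U\ge 0 \quad (\text{when } c=1),\\[1mm] \frac12\left[\,U\sqrt{U^2-\kappa^2}-\kappa^2\,\mathrm{arccosh}\left(\frac{U}{\kappa}\right)\right], & U>\kappa \quad (\text{when } c=1-\kappa^2,\ \kappa>0). \end{cases} $$ **(C)** There exist a two-parameter family of helicoidal $\mathcal{K}^{1/4}$-translators $\mathcal{H}^{h}_{c}$ and geometric coordinates $(U,t)$ on $\mathcal{H}^h_c$ satisfying the following conditions. - **(C1)** The geometric meaning of the parameter $h$ is that $\mathcal{H}^{h}_{c}$ is invariant under the helicoidal motion with pitch $h$: the surface $\mathcal{H}^{h}_{c}$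 is invariant under the one-parameter subgroup $\{\mathbf{S}_T\}$ of the group of rigid motions of $\mathbb{R}^3=\mathbb{C}\times\mathbb{R}$ given by $\mathbf{S}_T(\zeta,z)=(e^{iT}\zeta,\ hT+z)$. - **(C2)** There exist coordinates $(U,t)$ on the helicoidal surface $\mathcal{H}^{h}_{c}$ such that its metric reads $I_{\mathcal{H}^{h}_{c}}=(U^2+c)\,dU^2+U^2\,dt^2$. - **(C3)** The geometric meaning of the parameter $c$ is the property that the helicoidal surface $\mathcal{H}^{h}_{c}$ is isometric to the rotational surface $\mathcal{H}^{0}_{c}=\mathcal{H}_{c}$, where $\mathcal{H}_c$ is the surface in (B). - **(C4)** The geometric meaning of the coordinate $U$ is the property that the function $\frac{1}{\sqrt{U^2+c}}$ coincides with the angle function on $\mathcal{H}^{h}_{c}$ up to a sign.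
   Context: For a surface $\Sigma\subset\mathbb{R}^3$ with unit normal $\mathbf{n}_\Sigma$, the angle function on $\Sigma$ is $\cos(\theta_\Sigma)=\mathbf{n}_\Sigma\cdot(0,0,1)$, and $\mathcal{K}_\Sigma$ denotes the Gaussian curvature. The surface $\Sigma$ is called a $\mathcal{K}^{1/4}$-translator when $\mathcal{K}_\Sigma=\cos^4(\theta_\Sigma)$. A helicoidal surface of pitch $\mu$ (with pitch vector $(0,0,\mu)$) and generating curve $\gamma=(\mathcal{R},0,\Lambda)$ in the $xz$-plane is the surface that admits the parametrization $(u,\theta)\mapsto(\mathcal{R}\cos\theta,\ \mathcal{R}\sin\theta,\ \Lambda+\mu\theta)$, where $u$ denotes a parameter of the curve $\gamma$. A rotational surface is a helicoidal surface of pitch $0$; its generating curve is called its profile curve.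
   Formalization: In (C3) the surface of pitch h is isometric (with θ in ℝ) only to the part of H_c with the same U-range, as full isometry fails for h≠0; in (A) the pitches fill [-|μ|,|μ|] on all of Σ, and an open interval containing it only over compact parts of the generating curve. *)

theory Defs
  imports "HOL-Analysis.Analysis"
begin

section \<open>Smooth maps\<close>

primrec Ck_on :: "nat \<Rightarrow> 'a::euclidean_space set \<Rightarrow> ('a \<Rightarrow> 'b::euclidean_space) \<Rightarrow> bool" where
  "Ck_on 0 S f \<longleftrightarrow> continuous_on S f"
| "Ck_on (Suc k) S f \<longleftrightarrow>
     (\<forall>x\<in>S. f differentiable (at x)) \<and> (\<forall>v. Ck_on k S (\<lambda>x. frechet_derivative f (at x) v))"

text \<open>Derivatives are taken with respect to the full space, so the notion is meant for open sets.\<close>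

definition smooth_on :: "'a::euclidean_space set \<Rightarrow> ('a \<Rightarrow> 'b::euclidean_space) \<Rightarrow> bool" where
  "smooth_on S f \<longleftrightarrow> (\<forall>k. Ck_on k S f)"

definition diffeo :: "(real \<times> real) set \<Rightarrow> (real \<times> real) set \<Rightarrow> (real \<times> real \<Rightarrow> real \<times> real) \<Rightarrow> bool" where
  "diffeo D D' \<phi> \<longleftrightarrow> open D \<and> open D' \<and>
     (\<exists>\<psi>. homeomorphism D D' \<phi> \<psi> \<and> smooth_on D \<phi> \<and> smooth_on D' \<psi>)"


section \<open>Parametrized surfaces\<close>

definition d1 :: "(real \<times> real \<Rightarrow> real ^ 3) \<Rightarrow> real \<times> real \<Rightarrow> real ^ 3" where
  "d1 X p = frechet_derivative X (at p) (1, 0)"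

definition d2 :: "(real \<times> real \<Rightarrow> real ^ 3) \<Rightarrow> real \<times> real \<Rightarrow> real ^ 3" where
  "d2 X p = frechet_derivative X (at p) (0, 1)"

definition regular_patch :: "(real \<times> real) set \<Rightarrow> (real \<times> real \<Rightarrow> real ^ 3) \<Rightarrow> bool" where
  "regular_patch D X \<longleftrightarrow> open D \<and> smooth_on D X \<and> (\<forall>p\<in>D. cross3 (d1 X p) (d2 X p) \<noteq> 0)"

definition unit_normal :: "(real \<times> real \<Rightarrow> real ^ 3) \<Rightarrow> real \<times> real \<Rightarrow> real ^ 3" where
  "unit_normal X p =
     cross3 (d1 X p) (d2 X p) /\<^sub>R norm (cross3 (d1 X p) (d2 X p))"

definition angle_function :: "(real \<times> real \<Rightarrow> real ^ 3) \<Rightarrow> real \<times> real \<Rightarrow> real" where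
  "angle_function X p = unit_normal X p \<bullet> vector [0, 0, 1]"

definition ff_E :: "(real \<times> real \<Rightarrow> real ^ 3) \<Rightarrow> real \<times> real \<Rightarrow> real" where
  "ff_E X p = d1 X p \<bullet> d1 X p"

definition ff_F :: "(real \<times> real \<Rightarrow> real ^ 3) \<Rightarrow> real \<times> real \<Rightarrow> real" where
  "ff_F X p = d1 X p \<bullet> d2 X p"

definition ff_G :: "(real \<times> real \<Rightarrow> real ^ 3) \<Rightarrow> real \<times> real \<Rightarrow> real" where
  "ff_G X p = d2 X p \<bullet> d2 X p"

definition gauss_curvature :: "(real \<times> real \<Rightarrow> real ^ 3) \<Rightarrow> real \<times> real \<Rightarrow> real" where
  "gauss_curvature X p =
     ((d1 (d1 X) p \<bullet> unit_normal X p) * (d2 (d2 X) p \<bullet> unit_normal X p)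
        - (d2 (d1 X) p \<bullet> unit_normal X p)\<^sup>2)
     / (ff_E X p * ff_G X p - (ff_F X p)\<^sup>2)"

definition isometric_patches ::
  "(real \<times> real) set \<Rightarrow> (real \<times> real \<Rightarrow> real ^ 3) \<Rightarrow>
   (real \<times> real) set \<Rightarrow> (real \<times> real \<Rightarrow> real ^ 3) \<Rightarrow> bool" where
  "isometric_patches D X D' Y \<longleftrightarrow>
     (\<exists>\<phi>. diffeo D D' \<phi> \<and>
        (\<forall>p\<in>D. ff_E X p = ff_E (Y \<circ> \<phi>) p \<and> ff_F X p = ff_F (Y \<circ> \<phi>) p \<and> ff_G X p = ff_G (Y \<circ> \<phi>) p))"


section \<open>Translators by the fourth root of the Gaussian curvature\<close>

text \<open>The first notion is for immersed parametrized surfaces, which may intersect themselves;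
  the second one is for embedded regular surfaces, given as subsets of space.
  The condition is invariant under changes of parameters (the sign of the normal is irrelevant
  because of the even power), so for a subset it suffices to check it in one local
  parametrization around each point.\<close>

definition K14_patch :: "(real \<times> real) set \<Rightarrow> (real \<times> real \<Rightarrow> real ^ 3) \<Rightarrow> bool" where
  "K14_patch D X \<longleftrightarrow> regular_patch D X \<and> (\<forall>p\<in>D. gauss_curvature X p = (angle_function X p) ^ 4)"

definition local_parametrization ::
  "(real ^ 3) set \<Rightarrow> (real \<times> real) set \<Rightarrow> (real \<times> real \<Rightarrow> real ^ 3) \<Rightarrow> bool" where
  "local_parametrization \<Sigma> D X \<longleftrightarrow> regular_patch D X \<and>
     (\<exists>V g. open V \<and> homeomorphism D (\<Sigma> \<inter> V) X g)"

definition K14_translator :: "(real ^ 3) set \<Rightarrow> bool" where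
  "K14_translator \<Sigma> \<longleftrightarrow> \<Sigma> \<noteq> {} \<and>
     (\<forall>p\<in>\<Sigma>. \<exists>D X. local_parametrization \<Sigma> D X \<and> p \<in> X ` D \<and> K14_patch D X)"


section \<open>Helicoidal and rotational surfaces\<close>

definition helicoidal_map ::
  "real \<Rightarrow> (real \<Rightarrow> real) \<Rightarrow> (real \<Rightarrow> real) \<Rightarrow> real \<times> real \<Rightarrow> real ^ 3" where
  "helicoidal_map \<mu> R L = (\<lambda>(u, \<theta>). vector [R u * cos \<theta>, R u * sin \<theta>, L u + \<mu> * \<theta>])"

definition helicoidal_surface ::
  "real \<Rightarrow> real set \<Rightarrow> (real \<Rightarrow> real) \<Rightarrow> (real \<Rightarrow> real) \<Rightarrow> (real ^ 3) set" where
  "helicoidal_surface \<mu> P R L = helicoidal_map \<mu> R L ` (P \<times> UNIV)"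

definition generating_curve :: "real set \<Rightarrow> (real \<Rightarrow> real) \<Rightarrow> (real \<Rightarrow> real) \<Rightarrow> (real ^ 3) set" where
  "generating_curve P R L = (\<lambda>u. vector [R u, 0, L u]) ` P"

definition rotational_surface :: "(real ^ 3) set \<Rightarrow> bool" where
  "rotational_surface \<Sigma> \<longleftrightarrow>
     (\<exists>P R L. is_interval P \<and> P \<noteq> {} \<and> continuous_on P R \<and> continuous_on P L \<and>
        \<Sigma> = helicoidal_surface 0 P R L)"

definition helicoidal_translator ::
  "real \<Rightarrow> real set \<Rightarrow> (real \<Rightarrow> real) \<Rightarrow> (real \<Rightarrow> real) \<Rightarrow> bool" where
  "helicoidal_translator \<mu> I R L \<longleftrightarrow>
     open I \<and> is_interval I \<and> I \<noteq> {} \<and> smooth_on I R \<and> smooth_on I L \<and>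
     K14_patch (I \<times> UNIV) (helicoidal_map \<mu> R L)"

abbreviation rotational_translator ::
  "real set \<Rightarrow> (real \<Rightarrow> real) \<Rightarrow> (real \<Rightarrow> real) \<Rightarrow> bool" where
  "rotational_translator \<equiv> helicoidal_translator 0"

text \<open>A one-parameter family, indexed by the pitch \<open>h \<in> J\<close>, of helicoidal translators isometric to
  the helicoidal translator of pitch \<open>\<mu>\<close> generated by \<open>(R, 0, L)\<close>, which is its member for
  \<open>h = \<mu>\<close>. The family depends continuously on \<open>h\<close>.\<close>

definition isometric_translator_family ::
  "real \<Rightarrow> real set \<Rightarrow> (real \<Rightarrow> real) \<Rightarrow> (real \<Rightarrow> real) \<Rightarrow> real set \<Rightarrow>
   (real \<Rightarrow> real \<Rightarrow> real) \<Rightarrow> (real \<Rightarrow> real \<Rightarrow> real) \<Rightarrow> bool" where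
  "isometric_translator_family \<mu> I R L J Rf Lf \<longleftrightarrow>
     (\<forall>h\<in>J. helicoidal_translator h I (Rf h) (Lf h) \<and>
        isometric_patches (I \<times> UNIV) (helicoidal_map h (Rf h) (Lf h))
                          (I \<times> UNIV) (helicoidal_map \<mu> R L)) \<and>
     continuous_on (J \<times> I) (\<lambda>(h, u). (Rf h u, Lf h u)) \<and>
     \<mu> \<in> J \<and> (\<forall>p\<in>I \<times> UNIV. helicoidal_map \<mu> (Rf \<mu>) (Lf \<mu>) p = helicoidal_map \<mu> R L p) \<and>
     0 \<in> J \<and> rotational_translator I (Rf 0) (Lf 0)"

definition screw_motion :: "real \<Rightarrow> real \<Rightarrow> real ^ 3 \<Rightarrow> real ^ 3" where
  "screw_motion h T p =
     (let \<zeta> = exp (\<i> * of_real T) * Complex (p $ 1) (p $ 2) in vector [Re \<zeta>, Im \<zeta>, h * T + p $ 3])"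

definition congruent_sets :: "(real ^ 3) set \<Rightarrow> (real ^ 3) set \<Rightarrow> bool" where
  "congruent_sets A B \<longleftrightarrow> (\<exists>f. (\<forall>x y. dist (f x) (f y) = dist x y) \<and> f ` A = B)"

definition cylinder :: "real \<Rightarrow> real \<Rightarrow> real \<Rightarrow> (real ^ 3) set" where
  "cylinder a b r = {p. (p $ 1 - a)\<^sup>2 + (p $ 2 - b)\<^sup>2 = r\<^sup>2}"


section \<open>The explicit height functions\<close>

definition height :: "real \<Rightarrow> real \<Rightarrow> real" where
  "height c U =
     (if c > 1 then let \<kappa> = sqrt (c - 1) in (U * sqrt (U\<^sup>2 + \<kappa>\<^sup>2) + \<kappa>\<^sup>2 * arsinh (U / \<kappa>)) / 2
      else if c = 1 then U\<^sup>2 / 2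
      else let \<kappa> = sqrt (1 - c) in (U * sqrt (U\<^sup>2 - \<kappa>\<^sup>2) - \<kappa>\<^sup>2 * arcosh (U / \<kappa>)) / 2)"

definition height_domain :: "real \<Rightarrow> real set" where
  "height_domain c = (if c > 1 then {0<..} else if c = 1 then {0..} else {sqrt (1 - c)<..})"

lemma height_cases:
  "\<kappa> > 0 \<Longrightarrow> height (1 + \<kappa>\<^sup>2) U = 1/2 * (U * sqrt (U\<^sup>2 + \<kappa>\<^sup>2) + \<kappa>\<^sup>2 * arsinh (U / \<kappa>))"
  "height 1 U = 1/2 * U\<^sup>2"
  "\<kappa> > 0 \<Longrightarrow> height (1 - \<kappa>\<^sup>2) U = 1/2 * (U * sqrt (U\<^sup>2 - \<kappa>\<^sup>2) - \<kappa>\<^sup>2 * arcosh (U / \<kappa>))"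
  by (auto simp: height_def Let_def)

lemma height_domain_cases:
  "\<kappa> > 0 \<Longrightarrow> height_domain (1 + \<kappa>\<^sup>2) = {U. U > 0}"
  "height_domain 1 = {U. U \<ge> 0}"
  "\<kappa> > 0 \<Longrightarrow> height_domain (1 - \<kappa>\<^sup>2) = {U. U > \<kappa>}"
  by (auto simp: height_domain_def)

text \<open>Parameter range of the generating curve of the surface with pitch \<open>h\<close> and constant \<open>c\<close>,
  where \<open>a\<close> is the lower end of the range. Only the paraboloid (\<open>h = 0\<close>, \<open>c = 1\<close>) has a
  point on the axis, which is the lower end of its profile curve.\<close>

definition U_range :: "real \<Rightarrow> real \<Rightarrow> real \<Rightarrow> real set" where
  "U_range a h c = (if h = 0 \<and> c = 1 then {a..} else {a<..})"

end

theory Submission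
  imports Defs
begin

text \<open>Write \<open>w = E G - F\<^sup>2\<close> for a helicoidal patch and \<open>A = R R'\<close>. Then \<open>K w\<^sup>2 = A w'/2 - A' w\<close> and the
  angle function is \<open>A / sqrt w\<close>, so the translator equation \<open>A w'/2 - A' w = A\<^sup>4\<close> does not see the pitch.
  Bour's deformation keeps \<open>G = R\<^sup>2 + h\<^sup>2\<close> and \<open>w\<close> (hence \<open>A = G'/2\<close>) and varies \<open>h\<close>: it is
  \<open>R\<^sub>h = sqrt (G - h\<^sup>2)\<close>, \<open>L\<^sub>h' = sqrt (w (G - h\<^sup>2) - A\<^sup>2 G) / (G - h\<^sup>2)\<close>, and the members are isometric by a
  shear \<open>(u, t) \<mapsto> (u, t + \<psi> u)\<close> because \<open>I = w/G du\<^sup>2 + G (d\<theta> + F/G du)\<^sup>2\<close>. The radicand decreases with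
  \<open>h\<^sup>2\<close>, and at the given pitch it equals \<open>(R\<^sup>2 L')\<^sup>2\<close>, which vanishes nowhere on a translator; so all
  pitches between \<open>0\<close> and the given one are attained. The choice \<open>G = U\<^sup>2\<close>, \<open>w = U\<^sup>2 (U\<^sup>2 + c)\<close>
  gives the two-parameter family.\<close>

text \<open>What shapes the proof is the range of the deformation. At a pitch beyond the given one
  the radicand may turn negative near the ends of the parameter interval, however small the
  increase. Hence the whole interval carries only the pitches up to the given absolute value, and a
  uniform margin past it is obtained over compact subintervals. Since \<open>R\<close> and
  \<open>L'\<close> vanish nowhere, they have constant signs; with these signs and one initial
  height, the member at the given pitch is the given curve itself and not merely a congruent one.
  Embeddedness needs a separate argument, because a patch may cover its image many times. In the
  explicit family \<open>U\<close> is a function of the point alone, and the angle is read off from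
  the height if h is nonzero and, locally, from the polar angle if h = 0. The vertex of the
  paraboloid lies on the axis, where a rotational patch is singular, so that surface gets a graph
  chart.\<close>

section \<open>Calculus of smooth maps\<close>

lemma Ck_on_cong:
  assumes "open S" "\<And>x. x \<in> S \<Longrightarrow> f x = g x" "Ck_on k S f"
  shows "Ck_on k S g"
  using assms(2,3)
proof (induction k arbitrary: f g)
  case 0
  then show ?case by (auto cong: continuous_on_cong)
next
  case (Suc k)
  have der: "(g has_derivative frechet_derivative f (at x)) (at x)" if "x \<in> S" for x
    by (rule has_derivative_transform_within_open[OF _ assms(1) that Suc.prems(1)])
      (use Suc.prems(2) that in \<open>auto simp: frechet_derivative_works[symmetric]\<close>)
  have eq: "frechet_derivative f (at x) = frechet_derivative g (at x)" if "x \<in> S" for x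
    by (rule frechet_derivative_at[OF der[OF that]])
  show ?case
    using Suc.IH[of "\<lambda>x. frechet_derivative f (at x) v" "\<lambda>x. frechet_derivative g (at x) v" for v]
      Suc.prems(2) der eq by (auto simp: differentiable_def)
qed

text \<open>The regularity proofs below exhibit a derivative instead of computing
  \<open>frechet_derivative\<close>; uniqueness of derivatives at points of an open set identifies
  the two.\<close>

lemma Ck_on_SucI:
  assumes "open S" "\<And>x. x \<in> S \<Longrightarrow> (f has_derivative f' x) (at x)" "\<And>v. Ck_on k S (\<lambda>x. f' x v)"
  shows "Ck_on (Suc k) S f"
proof -
  have "f' x = frechet_derivative f (at x)" if "x \<in> S" for x
    by (rule frechet_derivative_at[OF assms(2)[OF that]])
  then have "Ck_on k S (\<lambda>x. frechet_derivative f (at x) v)" for v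
    by (intro Ck_on_cong[OF assms(1) _ assms(3)]) auto
  then show ?thesis
    using assms(2) by (auto simp: differentiable_def)
qed

lemma Ck_on_SucD: "Ck_on (Suc k) S f \<Longrightarrow> Ck_on k S f"
proof (induction k arbitrary: f)
  case 0
  then show ?case
    by (auto intro!: differentiable_imp_continuous_on simp: differentiable_on_def differentiable_at_withinI)
qed auto

lemma Ck_on_subset: "Ck_on k S f \<Longrightarrow> T \<subseteq> S \<Longrightarrow> Ck_on k T f"
  by (induction k arbitrary: f) (auto intro: continuous_on_subset)

lemma Ck_on_const: "open S \<Longrightarrow> Ck_on k S (\<lambda>x. c)"
  by (induction k arbitrary: c) (auto simp: frechet_derivative_const)

lemma Ck_on_linear:
  assumes "open S" "bounded_linear f"
  shows "Ck_on k S f"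
proof (cases k)
  case 0
  then show ?thesis using assms by (auto simp: linear_continuous_on)
next
  case (Suc n)
  show ?thesis unfolding Suc
    by (rule Ck_on_SucI[OF assms(1) bounded_linear_imp_has_derivative[OF assms(2)]])
      (rule Ck_on_const[OF assms(1)])
qed

lemma Ck_on_add:
  assumes "open S" "Ck_on k S f" "Ck_on k S g"
  shows "Ck_on k S (\<lambda>x. f x + g x)"
  using assms(2,3)
proof (induction k arbitrary: f g)
  case 0
  then show ?case by (auto intro: continuous_intros)
next
  case (Suc k)
  show ?case
    by (rule Ck_on_SucI[OF assms(1), where f' = "\<lambda>x v. frechet_derivative f (at x) v + frechet_derivative g (at x) v"])
      (use Suc in \<open>auto intro!: has_derivative_add simp: frechet_derivative_works[symmetric]\<close>)
qed

lemma Ck_on_sum: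
  assumes "open S" "finite A" "\<And>a. a \<in> A \<Longrightarrow> Ck_on k S (f a)"
  shows "Ck_on k S (\<lambda>x. \<Sum>a\<in>A. f a x)"
  using assms(2,3) by (induction A rule: finite_induct) (simp_all add: Ck_on_const Ck_on_add assms(1))

text \<open>One Leibniz rule serves products, scalar multiples and inner products. The derivative
  pairs each factor with the derivative of the other, so the induction also needs the factors
  themselves one order lower.\<close>

lemma Ck_on_bilinear:
  assumes "open S" "bounded_bilinear b" "Ck_on k S f" "Ck_on k S g"
  shows "Ck_on k S (\<lambda>x. b (f x) (g x))"
  using assms(3,4)
proof (induction k arbitrary: f g)
  case 0
  then show ?case by (auto intro: bounded_bilinear.continuous_on[OF assms(2)])
next
  case (Suc k)
  note lower = Suc.prems[THEN Ck_on_SucD]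
  show ?case
  proof (rule Ck_on_SucI[OF assms(1)])
    show "((\<lambda>x. b (f x) (g x)) has_derivative
        (\<lambda>v. b (f x) (frechet_derivative g (at x) v) + b (frechet_derivative f (at x) v) (g x))) (at x)"
      if "x \<in> S" for x
      by (rule bounded_bilinear.FDERIV[OF assms(2)]) (use Suc.prems that in \<open>auto simp: frechet_derivative_works[symmetric]\<close>)
    show "Ck_on k S (\<lambda>x. b (f x) (frechet_derivative g (at x) v) + b (frechet_derivative f (at x) v) (g x))" for v
      by (intro Ck_on_add assms(1) Suc.IH lower) (use Suc.prems in auto)
  qed
qed

text \<open>The chain rule produces f' (g x) applied to a direction that varies with x, whereas
  \<open>Ck_on\<close> controls f' only in fixed directions. Expanding g' x v in the standard basis
  turns it into a sum of products to which the induction hypothesis applies.\<close>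

lemma Ck_on_compose:
  fixes g :: "'a::euclidean_space \<Rightarrow> 'b::euclidean_space" and f :: "'b \<Rightarrow> 'c::euclidean_space"
  assumes "open S" "open T" "g ` S \<subseteq> T" "Ck_on k S g" "Ck_on k T f"
  shows "Ck_on k S (\<lambda>x. f (g x))"
  using assms(4,5)
proof (induction k arbitrary: f)
  case 0
  then show ?case using assms(3) by (auto intro: continuous_on_compose2)
next
  case (Suc k)
  let ?g' = "\<lambda>x. frechet_derivative g (at x)" and ?f' = "\<lambda>x. frechet_derivative f (at x)"
  show ?case
  proof (rule Ck_on_SucI[OF assms(1)])
    fix x assume x: "x \<in> S"
    have g: "(g has_derivative ?g' x) (at x)"
      using Suc.prems(1) x by (auto simp: frechet_derivative_works[symmetric])
    have f: "(f has_derivative ?f' (g x)) (at (g x))"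
      using Suc.prems(2) x assms(3) by (auto simp: frechet_derivative_works[symmetric])
    note lin = has_derivative_linear[OF f]
    have "?f' (g x) (\<Sum>i\<in>Basis. (?g' x v \<bullet> i) *\<^sub>R i)
        = (\<Sum>i\<in>Basis. (?g' x v \<bullet> i) *\<^sub>R ?f' (g x) i)" for v
      by (simp only: linear_sum[OF lin] linear_scale[OF lin])
    then have "?f' (g x) (?g' x v) = (\<Sum>i\<in>Basis. (?g' x v \<bullet> i) *\<^sub>R ?f' (g x) i)" for v
      by (simp only: euclidean_representation)
    with has_derivative_compose[OF g f]
    show "((\<lambda>x. f (g x)) has_derivative (\<lambda>v. \<Sum>i\<in>Basis. (?g' x v \<bullet> i) *\<^sub>R ?f' (g x) i)) (at x)"
      by simp
  next
    fix v
    have "Ck_on k S (\<lambda>x. (?g' x v \<bullet> i) *\<^sub>R ?f' (g x) i)" for i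
      by (intro Ck_on_bilinear[OF assms(1) bounded_bilinear_scaleR]
          Ck_on_bilinear[OF assms(1) bounded_bilinear_inner] Ck_on_const assms(1) Suc.IH
          Ck_on_SucD[OF Suc.prems(1)])
        (use Suc.prems in auto)
    then show "Ck_on k S (\<lambda>x. \<Sum>i\<in>Basis. (?g' x v \<bullet> i) *\<^sub>R ?f' (g x) i)"
      by (intro Ck_on_sum assms(1)) auto
  qed
qed

lemma smooth_on_cong:
  "open S \<Longrightarrow> (\<And>x. x \<in> S \<Longrightarrow> f x = g x) \<Longrightarrow> smooth_on S f \<Longrightarrow> smooth_on S g"
  unfolding smooth_on_def using Ck_on_cong by blast

lemma smooth_on_subset: "smooth_on S f \<Longrightarrow> T \<subseteq> S \<Longrightarrow> smooth_on T f"
  unfolding smooth_on_def using Ck_on_subset by blast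

lemma smooth_on_imp_continuous_on: "smooth_on S f \<Longrightarrow> continuous_on S f"
  unfolding smooth_on_def using Ck_on.simps(1) by blast

lemma smooth_on_const: "open S \<Longrightarrow> smooth_on S (\<lambda>x. c)"
  by (simp add: smooth_on_def Ck_on_const)

lemma smooth_on_linear: "open S \<Longrightarrow> bounded_linear f \<Longrightarrow> smooth_on S f"
  by (simp add: smooth_on_def Ck_on_linear)

lemma smooth_on_ident: "open S \<Longrightarrow> smooth_on S (\<lambda>x. x)"
  by (simp add: smooth_on_linear bounded_linear_ident)

lemma smooth_on_add: "open S \<Longrightarrow> smooth_on S f \<Longrightarrow> smooth_on S g \<Longrightarrow> smooth_on S (\<lambda>x. f x + g x)"
  by (simp add: smooth_on_def Ck_on_add)

lemma smooth_on_mult: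
  fixes f g :: "'a::euclidean_space \<Rightarrow> real"
  shows "open S \<Longrightarrow> smooth_on S f \<Longrightarrow> smooth_on S g \<Longrightarrow> smooth_on S (\<lambda>x. f x * g x)"
  by (simp add: smooth_on_def Ck_on_bilinear bounded_bilinear_mult)

lemma smooth_on_scaleR:
  "open S \<Longrightarrow> smooth_on S f \<Longrightarrow> smooth_on S g \<Longrightarrow> smooth_on S (\<lambda>x. f x *\<^sub>R g x)"
  by (simp add: smooth_on_def Ck_on_bilinear bounded_bilinear_scaleR)

lemma smooth_on_compose:
  "open S \<Longrightarrow> open T \<Longrightarrow> (\<And>x. x \<in> S \<Longrightarrow> g x \<in> T) \<Longrightarrow> smooth_on T f \<Longrightarrow> smooth_on S g
   \<Longrightarrow> smooth_on S (\<lambda>x. f (g x))"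
  unfolding smooth_on_def by (blast intro: Ck_on_compose)

lemma smooth_on_uminus: "open S \<Longrightarrow> smooth_on S f \<Longrightarrow> smooth_on S (\<lambda>x. - f x)"
  using smooth_on_scaleR[of S "\<lambda>_. -1" f] by (simp add: smooth_on_const)

lemma smooth_on_diff: "open S \<Longrightarrow> smooth_on S f \<Longrightarrow> smooth_on S g \<Longrightarrow> smooth_on S (\<lambda>x. f x - g x)"
  using smooth_on_add[of S f "\<lambda>x. - g x"] by (simp add: smooth_on_uminus)

lemma smooth_on_power:
  fixes f :: "'a::euclidean_space \<Rightarrow> real"
  shows "open S \<Longrightarrow> smooth_on S f \<Longrightarrow> smooth_on S (\<lambda>x. f x ^ n)"
  by (induction n) (simp_all add: smooth_on_const smooth_on_mult)

lemma smooth_on_Pair: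
  assumes "open S" "smooth_on S f" "smooth_on S g"
  shows "smooth_on S (\<lambda>x. (f x, g x))"
proof -
  have "smooth_on S (\<lambda>x. (f x, 0) + (0, g x))"
    using smooth_on_compose[OF assms(1) open_UNIV _ smooth_on_linear assms(2), of "\<lambda>x. (x, 0)"]
      smooth_on_compose[OF assms(1) open_UNIV _ smooth_on_linear assms(3), of "Pair 0"]
    by (intro smooth_on_add assms(1)) (simp_all add: bounded_linear_Pair bounded_linear_ident bounded_linear_zero)
  then show ?thesis by simp
qed

section \<open>Smooth functions of one real variable\<close>

lemma Ck_on_Suc_real:
  fixes f :: "real \<Rightarrow> real"
  assumes "open S" "\<And>x. x \<in> S \<Longrightarrow> (f has_real_derivative f' x) (at x)" "Ck_on k S f'"
  shows "Ck_on (Suc k) S f"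
proof (rule Ck_on_SucI[OF assms(1)])
  show "(f has_derivative (\<lambda>v. f' x * v)) (at x)" if "x \<in> S" for x
    using assms(2)[OF that] by (simp add: has_field_derivative_def)
  show "Ck_on k S (\<lambda>x. f' x * v)" for v
    by (intro Ck_on_bilinear[OF assms(1) bounded_bilinear_mult] Ck_on_const assms)
qed

lemma smooth_on_antiderivative:
  fixes f :: "real \<Rightarrow> real"
  assumes "open S" "\<And>x. x \<in> S \<Longrightarrow> (f has_real_derivative f' x) (at x)" "smooth_on S f'"
  shows "smooth_on S f"
  unfolding smooth_on_def
  using Ck_on_SucD[OF Ck_on_Suc_real[OF assms(1,2)]] assms(3) unfolding smooth_on_def by blast

lemma smooth_on_deriv:
  fixes f :: "real \<Rightarrow> real"
  assumes "open S" "smooth_on S f"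
  shows "\<And>x. x \<in> S \<Longrightarrow> (f has_real_derivative deriv f x) (at x)" "smooth_on S (deriv f)"
proof -
  have diff: "f differentiable (at x)" if "x \<in> S" for x
    using assms(2) that Ck_on.simps(2)[of 0 S f] unfolding smooth_on_def by blast
  show D: "(f has_real_derivative deriv f x) (at x)" if "x \<in> S" for x
    using diff[OF that] by (metis DERIV_imp_deriv real_differentiable_def)
  have "frechet_derivative f (at x) 1 = deriv f x" if "x \<in> S" for x
    using frechet_derivative_at[OF D[OF that, unfolded has_field_derivative_def]]
    by (metis mult.right_neutral)
  moreover have "smooth_on S (\<lambda>x. frechet_derivative f (at x) 1)"
    using assms(2) Ck_on.simps(2)[of _ S f] unfolding smooth_on_def by blast
  ultimately show "smooth_on S (deriv f)"
    using smooth_on_cong[OF assms(1), of "\<lambda>x. frechet_derivative f (at x) 1" "deriv f"] by blast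
qed

text \<open>Each function is, up to sign, the derivative of the other, so both go through one
  simultaneous induction.\<close>

lemma smooth_on_sin_cos: "smooth_on UNIV (sin :: real \<Rightarrow> real)" "smooth_on UNIV (cos :: real \<Rightarrow> real)"
proof -
  have "Ck_on k UNIV (sin :: real \<Rightarrow> real) \<and> Ck_on k UNIV (cos :: real \<Rightarrow> real)" for k
  proof (induction k)
    case 0
    then show ?case by (auto intro: continuous_intros)
  next
    case (Suc k)
    have "Ck_on k UNIV (\<lambda>x::real. - 1 * sin x)"
      by (intro Ck_on_bilinear[OF _ bounded_bilinear_mult] Ck_on_const) (use Suc in auto)
    then have "Ck_on k UNIV (\<lambda>x::real. - sin x)"
      by (simp del: Ck_on.simps)
    then have "Ck_on (Suc k) UNIV (cos :: real \<Rightarrow> real)"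
      by (intro Ck_on_Suc_real[OF open_UNIV DERIV_cos])
    moreover have "Ck_on (Suc k) UNIV (sin :: real \<Rightarrow> real)"
      using Suc by (intro Ck_on_Suc_real[OF open_UNIV DERIV_sin]) auto
    ultimately show ?case by blast
  qed
  then show "smooth_on UNIV (sin :: real \<Rightarrow> real)" "smooth_on UNIV (cos :: real \<Rightarrow> real)"
    by (auto simp: smooth_on_def)
qed

text \<open>The derivative is a polynomial in \<open>inverse\<close> itself, so order k yields order
  k + 1. The square root below works alike: its derivative is half of its own reciprocal.\<close>

lemma smooth_on_inverse_real: "smooth_on (- {0}) (inverse :: real \<Rightarrow> real)"
proof -
  have o: "open (- {0::real})" by auto
  have "Ck_on k (- {0}) (inverse :: real \<Rightarrow> real)" for k
  proof (induction k)
    case 0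
    then show ?case by (auto intro!: continuous_intros)
  next
    case (Suc k)
    have "Ck_on k (- {0}) (\<lambda>x::real. -1 * (inverse x * inverse x))"
      by (intro Ck_on_bilinear[OF o bounded_bilinear_mult] Ck_on_const o Suc)
    moreover have "(inverse has_real_derivative -1 * (inverse x * inverse x)) (at x)" if "x \<in> - {0}" for x
      using DERIV_inverse[of x] that by (simp add: power2_eq_square)
    ultimately show ?case
      by (intro Ck_on_Suc_real[OF o])
  qed
  then show ?thesis by (auto simp: smooth_on_def)
qed

lemma smooth_on_divide:
  fixes f g :: "'a::euclidean_space \<Rightarrow> real"
  assumes "open S" "smooth_on S f" "smooth_on S g" "\<And>x. x \<in> S \<Longrightarrow> g x \<noteq> 0"
  shows "smooth_on S (\<lambda>x. f x / g x)"
  unfolding divide_inverse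
  by (intro smooth_on_mult assms smooth_on_compose[OF assms(1) _ _ smooth_on_inverse_real]) (use assms(4) in auto)

lemma smooth_on_sqrt_real: "smooth_on {0<..} sqrt"
proof -
  have o: "open {0::real<..}" by auto
  have "Ck_on k {0<..} sqrt" for k
  proof (induction k)
    case 0
    then show ?case by (auto intro!: continuous_intros)
  next
    case (Suc k)
    have "Ck_on k {0<..} (\<lambda>x. inverse (sqrt x))"
      by (rule Ck_on_compose[OF o _ _ Suc, of "- {0}"])
        (use smooth_on_inverse_real in \<open>auto simp: smooth_on_def\<close>)
    then have "Ck_on k {0<..} (\<lambda>x. inverse (sqrt x) * (1/2))"
      by (intro Ck_on_bilinear[OF _ bounded_bilinear_mult] Ck_on_const) auto
    then show ?case
      by (intro Ck_on_Suc_real[OF o, where f' = "\<lambda>x. inverse (sqrt x) * (1/2)"])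
        (auto intro!: DERIV_real_sqrt)
  qed
  then show ?thesis by (auto simp: smooth_on_def)
qed

lemma smooth_on_sqrt:
  fixes f :: "'a::euclidean_space \<Rightarrow> real"
  assumes "open S" "smooth_on S f" "\<And>x. x \<in> S \<Longrightarrow> f x > 0"
  shows "smooth_on S (\<lambda>x. sqrt (f x))"
  by (rule smooth_on_compose[OF assms(1) _ _ smooth_on_sqrt_real assms(2)]) (use assms(3) in auto)

lemmas smooth_intros =
  smooth_on_const smooth_on_ident smooth_on_add smooth_on_diff smooth_on_uminus smooth_on_mult
  smooth_on_scaleR smooth_on_power smooth_on_divide smooth_on_sqrt smooth_on_Pair

lemma smooth_on_fst_snd:
  "open S \<Longrightarrow> smooth_on S (\<lambda>p::real \<times> real. fst p)" "open S \<Longrightarrow> smooth_on S (\<lambda>p::real \<times> real. snd p)"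
  by (auto intro!: smooth_on_linear bounded_linear_fst bounded_linear_snd)

section \<open>Antiderivatives depending on parameters\<close>

text \<open>The integral of f from b to u, rescaled to the unit interval. The domain of integration
  then does not depend on b and u, the orientation for u < b is built in, and continuity in
  parameters reduces to a parameter integral over a fixed compact set.\<close>

definition antideriv_from :: "real \<Rightarrow> (real \<Rightarrow> real) \<Rightarrow> real \<Rightarrow> real" where
  "antideriv_from b f u = (u - b) * integral {0..1} (\<lambda>t. f (b + (u - b) * t))"

lemma segment_in_interval:
  fixes b u t :: real
  assumes "is_interval I" "b \<in> I" "u \<in> I" "t \<in> {0..1}"
  shows "b + (u - b) * t \<in> I"
proof -
  have "b + (u - b) * t = (1 - t) *\<^sub>R b + t *\<^sub>R u" by (simp add: algebra_simps)
  then show ?thesis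
    using assms is_interval_convex[OF assms(1)] by (auto simp: convex_alt)
qed

text \<open>Substitution along the segment from b to u. The derivative is taken within I, so an
  interval that contains an endpoint is allowed; the profile of the paraboloid uses this.\<close>

lemma antideriv_from_eq:
  assumes "is_interval I" "b \<in> I" "u \<in> I" "\<And>x. x \<in> I \<Longrightarrow> (G has_real_derivative f x) (at x within I)"
  shows "antideriv_from b f u = G u - G b"
proof -
  have "((\<lambda>t. (u - b) * f (b + (u - b) * t)) has_integral G (b + (u - b) * 1) - G (b + (u - b) * 0)) {0..1}"
  proof (rule fundamental_theorem_of_calculus)
    fix t :: real assume t: "t \<in> {0..1}"
    have im: "(\<lambda>t. b + (u - b) * t) ` {0..1} \<subseteq> I"
      using segment_in_interval[OF assms(1-3)] by blast
    have "(G has_real_derivative f (b + (u - b) * t)) (at (b + (u - b) * t) within (\<lambda>t. b + (u - b) * t) ` {0..1})"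
      using assms(4)[of "b + (u - b) * t"] t im DERIV_subset by blast
    moreover have "((\<lambda>t. b + (u - b) * t) has_real_derivative (u - b)) (at t within {0..1})"
      by (auto intro!: derivative_eq_intros)
    ultimately have "((G \<circ> (\<lambda>t. b + (u - b) * t)) has_real_derivative f (b + (u - b) * t) * (u - b)) (at t within {0..1})"
      by (rule DERIV_image_chain)
    then show "((\<lambda>t. G (b + (u - b) * t)) has_vector_derivative (u - b) * f (b + (u - b) * t)) (at t within {0..1})"
      by (simp add: has_real_derivative_iff_has_vector_derivative[symmetric] o_def mult.commute)
  qed simp
  then have "integral {0..1} (\<lambda>t. (u - b) * f (b + (u - b) * t)) = G u - G b"
    by (rule integral_unique[THEN trans]) simp
  then show ?thesis
    by (simp add: antideriv_from_def)
qed

lemma antideriv_from_has_derivative: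
  assumes "open I" "is_interval I" "b \<in> I" "continuous_on I f" "u \<in> I"
  shows "(antideriv_from b f has_real_derivative f u) (at u)"
proof -
  obtain e where e: "e > 0" "cball u e \<subseteq> I"
    using assms(1,5) open_contains_cball by blast
  \<comment> \<open>A compact interval inside I that contains b and has u in its interior: on it an
    antiderivative G exists, and differentiability of G within it is ordinary differentiability at
    u.\<close>
  define l r where "l = min b (u - e)" and "r = max b (u + e)"
  have "u - e \<in> I" "u + e \<in> I" using e by (auto simp: subset_eq dist_real_def)
  then have lr: "l \<in> I" "r \<in> I" using assms(3) by (auto simp: l_def r_def min_def max_def)
  have sub: "{l..r} \<subseteq> I"
    using assms(2) lr unfolding is_interval_1 by (meson atLeastAtMost_iff subsetI)
  obtain G where G: "\<And>x. x \<in> {l..r} \<Longrightarrow> (G has_vector_derivative f x) (at x within {l..r})"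
    using antiderivative_continuous[OF continuous_on_subset[OF assms(4) sub]] by blast
  then have G': "(G has_real_derivative f x) (at x within {l..r})" if "x \<in> {l..r}" for x
    using that by (simp add: has_real_derivative_iff_has_vector_derivative)
  have eq: "antideriv_from b f x = G x - G b" if "x \<in> {l..r}" for x
    by (rule antideriv_from_eq[OF is_interval_cc _ that G']) (use e in \<open>auto simp: l_def r_def\<close>)
  have u: "u \<in> {l<..<r}" using e by (auto simp: l_def r_def)
  have "(G has_real_derivative f u) (at u)"
    using G'[of u] u at_within_interior[of u "{l..r}"] by (auto simp: interior_atLeastAtMost_real)
  then have "((\<lambda>x. G x - G b) has_real_derivative f u) (at u)"
    by (auto intro!: derivative_eq_intros)
  then show ?thesis
    by (rule has_field_derivative_transform_within_open[where S = "{l<..<r}"])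
      (use u eq in auto)
qed

text \<open>The base point, the upper limit and the integrand may all vary with the parameter s. W
  is a set of joint continuity of the integrand that contains every segment of integration.\<close>

lemma continuous_on_antideriv_from:
  fixes b u :: "'a::topological_space \<Rightarrow> real"
  assumes "continuous_on S b" "continuous_on S u" "continuous_on W (\<lambda>(s, x). f s x)"
    and "\<And>s t. s \<in> S \<Longrightarrow> t \<in> {0..1} \<Longrightarrow> (s, b s + (u s - b s) * t) \<in> W"
  shows "continuous_on S (\<lambda>s. antideriv_from (b s) (f s) (u s))"
proof -
  have "continuous_on (S \<times> cbox 0 1) (\<lambda>(s, t). f s (b s + (u s - b s) * t))"
  proof -
    have b: "continuous_on (S \<times> {0..1::real}) (\<lambda>p. b (fst p))" 
      by (rule continuous_on_compose2[OF assms(1)]) (auto intro: continuous_intros)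
    have u: "continuous_on (S \<times> {0..1::real}) (\<lambda>p. u (fst p))" 
      by (rule continuous_on_compose2[OF assms(2)]) (auto intro: continuous_intros)
    have "continuous_on (S \<times> {0..1}) (\<lambda>p. (\<lambda>(s, x). f s x) (fst p, b (fst p) + (u (fst p) - b (fst p)) * snd p))"
      by (rule continuous_on_compose2[OF assms(3)]) (use assms(4) b u in \<open>auto intro!: continuous_intros\<close>)
    then show ?thesis by (simp add: case_prod_beta')
  qed
  from integral_continuous_on_param[OF this]
  show ?thesis
    unfolding antideriv_from_def by (auto intro!: continuous_intros assms)
qed

section \<open>Derivatives of parametrized surfaces\<close>

lemma vec3_eq: "vector [x, y, z] = x *\<^sub>R axis 1 1 + y *\<^sub>R axis 2 1 + (z::real) *\<^sub>R (axis 3 1 :: real^3)"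
  by (simp add: vec_eq_iff forall_3 axis_def)

lemma inner_vec3: "(vector [a, b, c] :: real^3) \<bullet> vector [x, y, z] = a * x + b * y + c * z"
  by (simp add: inner_vec_def sum_3)

lemma cross_vec3:
  "cross3 (vector [a, b, c]) (vector [x, y, z]) = vector [b * z - c * y, c * x - a * z, a * y - b * x]"
  by (simp add: cross3_def)

lemma norm_vec3: "norm (vector [a, b, c] :: real^3) = sqrt (a\<^sup>2 + b\<^sup>2 + c\<^sup>2)"
  by (simp add: norm_eq_sqrt_inner inner_vec3 power2_eq_square)

lemma vec3_eq_0: "(vector [a, b, c] :: real^3) = 0 \<longleftrightarrow> a = 0 \<and> b = 0 \<and> c = 0"
  by (simp add: vec_eq_iff forall_3)

lemma has_derivative_vec3:
  assumes "(x has_derivative x') F" "(y has_derivative y') F" "(z has_derivative z') F"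
  shows "((\<lambda>p. vector [x p, y p, z p] :: real^3) has_derivative (\<lambda>v. vector [x' v, y' v, z' v])) F"
  unfolding vec3_eq by (intro has_derivative_add has_derivative_scaleR_left assms)

lemma smooth_on_vec3:
  assumes "open S" "smooth_on S x" "smooth_on S y" "smooth_on S z"
  shows "smooth_on S (\<lambda>p. vector [x p, y p, z p] :: real^3)"
  unfolding vec3_eq by (intro smooth_intros assms)

lemma d_eqI:
  assumes "(X has_derivative X') (at p)"
  shows "d1 X p = X' (1, 0)" "d2 X p = X' (0, 1)"
  using frechet_derivative_at[OF assms] by (auto simp: d1_def d2_def)

text \<open>Partial derivatives depend only on the germ. This is what permits differentiating
  \<open>d1 X\<close> again when its formula is known only on D.\<close>

lemma d_cong:
  assumes "open D" "p \<in> D" "\<And>q. q \<in> D \<Longrightarrow> X q = Y q"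
  shows "d1 X p = d1 Y p" "d2 X p = d2 Y p"
proof -
  have "(X has_derivative X') (at p) \<longleftrightarrow> (Y has_derivative X') (at p)" for X'
    using has_derivative_transform_within_open[OF _ assms(1,2)] assms(3) by metis
  then show "d1 X p = d1 Y p" "d2 X p = d2 Y p"
    by (simp_all add: d1_def d2_def frechet_derivative_def)
qed

lemma d_add_const: "d1 (\<lambda>q. v + X q) = d1 X" "d2 (\<lambda>q. v + X q) = d2 X"
proof -
  have "((\<lambda>q. v + X q) has_derivative X') F \<longleftrightarrow> (X has_derivative X') F" for X' F
    using has_derivative_add[OF has_derivative_const[of v] , of X X' F]
      has_derivative_add[OF has_derivative_const[of "- v"], of "\<lambda>q. v + X q" X' F] by auto
  then show "d1 (\<lambda>q. v + X q) = d1 X" "d2 (\<lambda>q. v + X q) = d2 X"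
    by (simp_all add: d1_def d2_def frechet_derivative_def fun_eq_iff)
qed

lemma K14_patch_add_const:
  assumes "K14_patch D X"
  shows "K14_patch D (\<lambda>q. v + X q)"
proof -
  have "unit_normal (\<lambda>q. v + X q) = unit_normal X"
    by (simp add: unit_normal_def d_add_const fun_eq_iff)
  then show ?thesis
    using assms smooth_on_add[OF _ smooth_on_const, of D X v]
    by (auto simp: K14_patch_def regular_patch_def gauss_curvature_def angle_function_def d_add_const
        ff_E_def ff_F_def ff_G_def)
qed

lemma K14_patch_subset: "K14_patch D X \<Longrightarrow> D' \<subseteq> D \<Longrightarrow> open D' \<Longrightarrow> K14_patch D' X"
  unfolding K14_patch_def regular_patch_def by (auto intro: smooth_on_subset)

text \<open>By the Lagrange identity, E G - F^2 is the squared norm of n. Hence both sides of the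
  translator equation have the denominator \<open>norm n ^ 4\<close>, and clearing it leaves a
  condition free of square roots.\<close>

lemma K14_condition_iff:
  assumes "cross3 (d1 X p) (d2 X p) \<noteq> 0"
  defines "n \<equiv> cross3 (d1 X p) (d2 X p)"
  shows "gauss_curvature X p = angle_function X p ^ 4 \<longleftrightarrow>
     (d1 (d1 X) p \<bullet> n) * (d2 (d2 X) p \<bullet> n) - (d2 (d1 X) p \<bullet> n)\<^sup>2 = (n \<bullet> vector [0, 0, 1]) ^ 4"
proof -
  have n: "norm n > 0" using assms by simp
  have "ff_E X p * ff_G X p - (ff_F X p)\<^sup>2 = (norm n)\<^sup>2"
    using norm_cross[of "d1 X p" "d2 X p"]
    by (simp add: n_def ff_E_def ff_F_def ff_G_def power2_norm_eq_inner algebra_simps power_mult_distrib)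
  moreover have "v \<bullet> unit_normal X p = (v \<bullet> n) / norm n" for v
    by (simp add: unit_normal_def n_def divide_inverse mult.commute)
  moreover have "angle_function X p = (n \<bullet> vector [0, 0, 1]) / norm n"
    by (simp add: angle_function_def unit_normal_def n_def divide_inverse mult.commute)
  moreover have "(x / m) * (y / m) - (z / m)\<^sup>2 = (x * y - z\<^sup>2) / m\<^sup>2" for x y z m :: real
    by (simp add: power2_eq_square diff_divide_distrib)
  ultimately have "gauss_curvature X p = ((d1 (d1 X) p \<bullet> n) * (d2 (d2 X) p \<bullet> n) - (d2 (d1 X) p \<bullet> n)\<^sup>2) / norm n ^ 4"
    "angle_function X p ^ 4 = (n \<bullet> vector [0, 0, 1]) ^ 4 / norm n ^ 4"
    by (simp_all add: gauss_curvature_def power_divide flip: power_add)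
  then show ?thesis using n by simp
qed

section \<open>Geometry of helicoidal patches\<close>

text \<open>The functions in place of cosine and sine are arbitrary so that the shape is closed
  under partial derivatives: a helicoidal patch and both of its first partials are
  instances.\<close>

lemma d_screw_form:
  fixes k :: real
  assumes "(a has_real_derivative a') (at u)" "(b has_real_derivative b') (at u)"
    and "(c has_real_derivative c') (at \<theta>)" "(s has_real_derivative s') (at \<theta>)"
  defines "X \<equiv> \<lambda>(u, \<theta>). vector [a u * c \<theta>, a u * s \<theta>, b u + k * \<theta>] :: real^3"
  shows "X differentiable (at (u, \<theta>))"
    "d1 X (u, \<theta>) = vector [a' * c \<theta>, a' * s \<theta>, b']"
    "d2 X (u, \<theta>) = vector [a u * c', a u * s', k]"
proof -
  have fst: "((\<lambda>p. f (fst p)) has_derivative (\<lambda>v. f' * fst v)) (at (u, \<theta>))"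
    if "(f has_real_derivative f') (at u)" for f f'
    using has_derivative_compose[OF has_derivative_fst[OF has_derivative_ident], of f "(*) f'" "(u, \<theta>)"] that
    by (simp add: has_field_derivative_def)
  have snd: "((\<lambda>p. f (snd p)) has_derivative (\<lambda>v. f' * snd v)) (at (u, \<theta>))"
    if "(f has_real_derivative f') (at \<theta>)" for f f'
    using has_derivative_compose[OF has_derivative_snd[OF has_derivative_ident], of f "(*) f'" "(u, \<theta>)"] that
    by (simp add: has_field_derivative_def)
  have k: "((\<lambda>\<theta>. k * \<theta>) has_real_derivative k) (at \<theta>)"
    by (auto intro!: derivative_eq_intros)
  have X: "(X has_derivative (\<lambda>v. vector [a u * (c' * snd v) + (a' * fst v) * c \<theta>,
      a u * (s' * snd v) + (a' * fst v) * s \<theta>, b' * fst v + k * snd v])) (at (u, \<theta>))"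
    unfolding X_def case_prod_beta'
    by (rule has_derivative_vec3)
      (use has_derivative_mult[OF fst[OF assms(1)] snd[OF assms(3)]]
        has_derivative_mult[OF fst[OF assms(1)] snd[OF assms(4)]]
        has_derivative_add[OF fst[OF assms(2)] snd[OF k]] in simp_all)
  then show "X differentiable (at (u, \<theta>))" by (auto simp: differentiable_def)
  show "d1 X (u, \<theta>) = vector [a' * c \<theta>, a' * s \<theta>, b']" "d2 X (u, \<theta>) = vector [a u * c', a u * s', k]"
    using d_eqI[OF X] by simp_all
qed

lemma helicoidal_map_derivatives:
  fixes h :: real
  assumes "open I" "u \<in> I"
    and R: "\<And>u. u \<in> I \<Longrightarrow> (R has_real_derivative R1 u) (at u)" "\<And>u. u \<in> I \<Longrightarrow> (R1 has_real_derivative R2 u) (at u)"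
    and L: "\<And>u. u \<in> I \<Longrightarrow> (L has_real_derivative L1 u) (at u)" "\<And>u. u \<in> I \<Longrightarrow> (L1 has_real_derivative L2 u) (at u)"
  defines "X \<equiv> helicoidal_map h R L"
  shows "X differentiable (at (u, \<theta>))"
    "d1 X (u, \<theta>) = vector [R1 u * cos \<theta>, R1 u * sin \<theta>, L1 u]"
    "d2 X (u, \<theta>) = vector [- (R u * sin \<theta>), R u * cos \<theta>, h]"
    "d1 (d1 X) (u, \<theta>) = vector [R2 u * cos \<theta>, R2 u * sin \<theta>, L2 u]"
    "d2 (d1 X) (u, \<theta>) = vector [- (R1 u * sin \<theta>), R1 u * cos \<theta>, 0]"
    "d2 (d2 X) (u, \<theta>) = vector [- (R u * cos \<theta>), - (R u * sin \<theta>), 0]"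
proof -
  have trig: "((\<lambda>x. - sin x) has_real_derivative - cos \<theta>) (at \<theta>)" for \<theta>
    by (auto intro!: derivative_eq_intros)
  show "X differentiable (at (u, \<theta>))"
    using d_screw_form(1)[OF R(1) L(1) DERIV_cos DERIV_sin] assms(2) by (simp add: X_def helicoidal_map_def)
  \<comment> \<open>The summands \<open>0 * \<theta>\<close> put the first partials into the shape
    of \<open>d_screw_form\<close> with k = 0, ready to be differentiated once more.\<close>
  have first: "d1 X q = (case q of (u, \<theta>) \<Rightarrow> vector [R1 u * cos \<theta>, R1 u * sin \<theta>, L1 u + 0 * \<theta>])"
    "d2 X q = (case q of (u, \<theta>) \<Rightarrow> vector [R u * - sin \<theta>, R u * cos \<theta>, h + 0 * \<theta>])" if "q \<in> I \<times> UNIV" for q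
    using that d_screw_form(2,3)[OF R(1) L(1) DERIV_cos DERIV_sin]
    by (auto simp: X_def helicoidal_map_def)
  from first[of "(u, \<theta>)"] show "d1 X (u, \<theta>) = vector [R1 u * cos \<theta>, R1 u * sin \<theta>, L1 u]"
    "d2 X (u, \<theta>) = vector [- (R u * sin \<theta>), R u * cos \<theta>, h]" using assms(2) by auto
  have op: "open (I \<times> (UNIV :: real set))" and mem: "(u, \<theta>) \<in> I \<times> UNIV"
    using assms by (auto intro: open_Times)
  have second:
    "d1 (d1 X) (u, \<theta>) = d1 (\<lambda>(u, \<theta>). vector [R1 u * cos \<theta>, R1 u * sin \<theta>, L1 u + 0 * \<theta>]) (u, \<theta>)"
    "d2 (d1 X) (u, \<theta>) = d2 (\<lambda>(u, \<theta>). vector [R1 u * cos \<theta>, R1 u * sin \<theta>, L1 u + 0 * \<theta>]) (u, \<theta>)"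
    "d2 (d2 X) (u, \<theta>) = d2 (\<lambda>(u, \<theta>). vector [R u * - sin \<theta>, R u * cos \<theta>, h + 0 * \<theta>]) (u, \<theta>)"
    by (intro d_cong[OF op mem] first; assumption)+
  show "d1 (d1 X) (u, \<theta>) = vector [R2 u * cos \<theta>, R2 u * sin \<theta>, L2 u]"
    "d2 (d1 X) (u, \<theta>) = vector [- (R1 u * sin \<theta>), R1 u * cos \<theta>, 0]"
    "d2 (d2 X) (u, \<theta>) = vector [- (R u * cos \<theta>), - (R u * sin \<theta>), 0]"
    unfolding second
    using d_screw_form(2,3)[OF R(2) L(2) DERIV_cos DERIV_sin, where u = u and k = 0 and \<theta> = \<theta>]
      d_screw_form(3)[OF R(1) DERIV_const trig DERIV_cos, where u = u and k = 0 and \<theta> = \<theta>] assms(2)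
    by simp_all
qed

lemma smooth_on_helicoidal_map:
  assumes "open I" "smooth_on I R" "smooth_on I L"
  shows "smooth_on (I \<times> UNIV) (helicoidal_map h R L)"
proof -
  have op: "open (I \<times> (UNIV :: real set))" using assms(1) by (auto intro: open_Times)
  have fst: "smooth_on (I \<times> UNIV) (\<lambda>p::real \<times> real. f (fst p))" if "smooth_on I f" for f :: "real \<Rightarrow> real"
    using smooth_on_compose[OF op assms(1) _ that smooth_on_fst_snd(1)[OF op]] by auto
  have snd: "smooth_on (I \<times> UNIV) (\<lambda>p::real \<times> real. f (snd p))" if "smooth_on UNIV f" for f :: "real \<Rightarrow> real"
    using smooth_on_compose[OF op open_UNIV _ that smooth_on_fst_snd(2)[OF op]] by auto
  show ?thesis
    unfolding helicoidal_map_def case_prod_beta'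
    by (intro smooth_on_vec3 smooth_intros op fst snd assms(2,3) smooth_on_sin_cos smooth_on_fst_snd)
qed

lemma helicoidal_fundamental_forms:
  fixes h :: real
  assumes "open I" "u \<in> I" "smooth_on I R" "smooth_on I L"
  defines "X \<equiv> helicoidal_map h R L"
  shows "ff_E X (u, \<theta>) = (deriv R u)\<^sup>2 + (deriv L u)\<^sup>2"
    "ff_F X (u, \<theta>) = h * deriv L u"
    "ff_G X (u, \<theta>) = (R u)\<^sup>2 + h\<^sup>2"
    "cross3 (d1 X (u, \<theta>)) (d2 X (u, \<theta>)) = vector [deriv R u * sin \<theta> * h - deriv L u * R u * cos \<theta>,
       - (deriv L u * R u * sin \<theta>) - deriv R u * cos \<theta> * h, R u * deriv R u]"
    "norm (cross3 (d1 X (u, \<theta>)) (d2 X (u, \<theta>)))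
       = sqrt (((R u)\<^sup>2 + h\<^sup>2) * (deriv R u)\<^sup>2 + (deriv L u)\<^sup>2 * (R u)\<^sup>2)"
    "angle_function X (u, \<theta>) = R u * deriv R u / sqrt (((R u)\<^sup>2 + h\<^sup>2) * (deriv R u)\<^sup>2 + (deriv L u)\<^sup>2 * (R u)\<^sup>2)"
proof -
  have D: "d1 X (u, \<theta>) = vector [deriv R u * cos \<theta>, deriv R u * sin \<theta>, deriv L u]"
    "d2 X (u, \<theta>) = vector [- (R u * sin \<theta>), R u * cos \<theta>, h]"
    using helicoidal_map_derivatives(2,3)[OF assms(1,2) smooth_on_deriv(1)[OF assms(1,3)]
      smooth_on_deriv(1)[OF assms(1) smooth_on_deriv(2)[OF assms(1,3)]] smooth_on_deriv(1)[OF assms(1,4)]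
      smooth_on_deriv(1)[OF assms(1) smooth_on_deriv(2)[OF assms(1,4)]], of h \<theta>, folded X_def]
    by auto
  have sc: "(sin \<theta>)\<^sup>2 = 1 - (cos \<theta>)\<^sup>2" by (simp add: sin_squared_eq)
  show "ff_E X (u, \<theta>) = (deriv R u)\<^sup>2 + (deriv L u)\<^sup>2"
    using sc unfolding ff_E_def D inner_vec3 by algebra
  show "ff_F X (u, \<theta>) = h * deriv L u"
    unfolding ff_F_def D inner_vec3 by simp
  show "ff_G X (u, \<theta>) = (R u)\<^sup>2 + h\<^sup>2"
    using sc unfolding ff_G_def D inner_vec3 by algebra
  show n: "cross3 (d1 X (u, \<theta>)) (d2 X (u, \<theta>)) = vector [deriv R u * sin \<theta> * h - deriv L u * R u * cos \<theta>,
       - (deriv L u * R u * sin \<theta>) - deriv R u * cos \<theta> * h, R u * deriv R u]"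
    unfolding D cross_vec3 by (simp add: vec_eq_iff forall_3 algebra_simps)
      (use sc in algebra)
  show N: "norm (cross3 (d1 X (u, \<theta>)) (d2 X (u, \<theta>)))
       = sqrt (((R u)\<^sup>2 + h\<^sup>2) * (deriv R u)\<^sup>2 + (deriv L u)\<^sup>2 * (R u)\<^sup>2)"
    unfolding n norm_vec3 by (rule arg_cong[where f = sqrt]) (use sc in algebra)
  show "angle_function X (u, \<theta>) = R u * deriv R u / sqrt (((R u)\<^sup>2 + h\<^sup>2) * (deriv R u)\<^sup>2 + (deriv L u)\<^sup>2 * (R u)\<^sup>2)"
    unfolding angle_function_def unit_normal_def N unfolding n
    by (simp add: inner_vec3 divide_inverse mult.commute)
qed

lemma area_form_derivatives:
  assumes "(R has_real_derivative R1 u) (at u)" "(R1 has_real_derivative R2) (at u)"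
    "(L has_real_derivative L1 u) (at u)" "(L1 has_real_derivative L2) (at u)"
  shows "((\<lambda>u. R u * R1 u) has_real_derivative (R1 u)\<^sup>2 + R u * R2) (at u)"
    "((\<lambda>u. ((R u)\<^sup>2 + h\<^sup>2) * (R1 u)\<^sup>2 + (L1 u)\<^sup>2 * (R u)\<^sup>2) has_real_derivative
      2 * R u * R1 u * (R1 u)\<^sup>2 + ((R u)\<^sup>2 + h\<^sup>2) * (2 * R1 u * R2)
        + 2 * L1 u * L2 * (R u)\<^sup>2 + (L1 u)\<^sup>2 * (2 * R u * R1 u)) (at u)"
  using assms by (auto intro!: derivative_eq_intros simp: algebra_simps power2_eq_square)

text \<open>By the Theorema Egregium the condition only involves the first fundamental form and the
  angle function; here it is expressed by \<open>A = R R'\<close> and \<open>w = E G - F\<^sup>2\<close>, which Bour's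
  deformation preserves.\<close>

lemma K14_helicoidal_iff:
  assumes "open I" "smooth_on I R" "smooth_on I L"
    and A: "\<And>u. u \<in> I \<Longrightarrow> A u = R u * deriv R u" "\<And>u. u \<in> I \<Longrightarrow> (A has_real_derivative A' u) (at u)"
    and w: "\<And>u. u \<in> I \<Longrightarrow> w u = ((R u)\<^sup>2 + h\<^sup>2) * (deriv R u)\<^sup>2 + (deriv L u)\<^sup>2 * (R u)\<^sup>2"
      "\<And>u. u \<in> I \<Longrightarrow> (w has_real_derivative w' u) (at u)"
  shows "K14_patch (I \<times> UNIV) (helicoidal_map h R L) \<longleftrightarrow>
    (\<forall>u\<in>I. w u > 0 \<and> A u * w' u / 2 - A' u * w u = A u ^ 4)"
proof -
  define X where "X = helicoidal_map h R L"
  define R1 R2 L1 L2 where "R1 = deriv R" and "R2 = deriv R1" and "L1 = deriv L" and "L2 = deriv L1"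
  have D: "(R has_real_derivative R1 u) (at u)" "(R1 has_real_derivative R2 u) (at u)"
    "(L has_real_derivative L1 u) (at u)" "(L1 has_real_derivative L2 u) (at u)" if "u \<in> I" for u
    using that smooth_on_deriv[OF assms(1,2)] smooth_on_deriv[OF assms(1,3)] smooth_on_deriv(1)[OF assms(1)]
    by (auto simp: R1_def R2_def L1_def L2_def)
  have reg: "cross3 (d1 X (u, \<theta>)) (d2 X (u, \<theta>)) \<noteq> 0 \<longleftrightarrow> w u > 0" if "u \<in> I" for u \<theta>
  proof -
    have "norm (cross3 (d1 X (u, \<theta>)) (d2 X (u, \<theta>))) = sqrt (w u)"
      using helicoidal_fundamental_forms(5)[OF assms(1) that assms(2,3), of h \<theta>] w(1)[OF that] by (simp add: X_def)
    moreover have "w u \<ge> 0" using w(1)[OF that] by simp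
    ultimately show ?thesis
      by (metis less_eq_real_def norm_eq_zero real_sqrt_eq_0_iff less_irrefl)
  qed
  have K: "gauss_curvature X (u, \<theta>) = angle_function X (u, \<theta>) ^ 4 \<longleftrightarrow> A u * w' u / 2 - A' u * w u = A u ^ 4"
    if u: "u \<in> I" and pos: "w u > 0" for u \<theta>
  proof -
    have A1: "A' u = (R1 u)\<^sup>2 + R u * R2 u"
    proof (rule DERIV_unique)
      have "((\<lambda>u. R u * R1 u) has_real_derivative (R1 u)\<^sup>2 + R u * R2 u) (at u)"
        by (rule area_form_derivatives(1)[OF D[OF u]])
      then show "(A has_real_derivative (R1 u)\<^sup>2 + R u * R2 u) (at u)"
        by (rule has_field_derivative_transform_within_open[OF _ assms(1) u]) (simp add: A R1_def)
    qed (rule A(2)[OF u])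
    have w1: "w' u = 2 * R u * R1 u * (R1 u)\<^sup>2 + ((R u)\<^sup>2 + h\<^sup>2) * (2 * R1 u * R2 u)
        + 2 * L1 u * L2 u * (R u)\<^sup>2 + (L1 u)\<^sup>2 * (2 * R u * R1 u)" (is "_ = ?rhs")
    proof (rule DERIV_unique)
      have "((\<lambda>u. ((R u)\<^sup>2 + h\<^sup>2) * (R1 u)\<^sup>2 + (L1 u)\<^sup>2 * (R u)\<^sup>2) has_real_derivative ?rhs) (at u)"
        by (rule area_form_derivatives(2)[OF D[OF u]])
      then show "(w has_real_derivative ?rhs) (at u)"
        by (rule has_field_derivative_transform_within_open[OF _ assms(1) u]) (simp add: w R1_def L1_def)
    qed (rule w(2)[OF u])
    define n where "n = cross3 (d1 X (u, \<theta>)) (d2 X (u, \<theta>))"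
    have n: "n = vector [R1 u * sin \<theta> * h - L1 u * R u * cos \<theta>,
       - (L1 u * R u * sin \<theta>) - R1 u * cos \<theta> * h, R u * R1 u]"
      using helicoidal_fundamental_forms(4)[OF assms(1) u assms(2,3), of h \<theta>]
      by (simp add: n_def X_def R1_def L1_def)
    have sc: "(sin \<theta>)\<^sup>2 = 1 - (cos \<theta>)\<^sup>2" by (simp add: sin_squared_eq)
    have D2: "d1 (d1 X) (u, \<theta>) = vector [R2 u * cos \<theta>, R2 u * sin \<theta>, L2 u]"
      "d2 (d1 X) (u, \<theta>) = vector [- (R1 u * sin \<theta>), R1 u * cos \<theta>, 0]"
      "d2 (d2 X) (u, \<theta>) = vector [- (R u * cos \<theta>), - (R u * sin \<theta>), 0]"
      using helicoidal_map_derivatives(4-6)[OF assms(1) u D, of h \<theta>, folded X_def] by auto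
    have "d1 (d1 X) (u, \<theta>) \<bullet> n = R u * (R1 u * L2 u - R2 u * L1 u)"
      unfolding D2 n inner_vec3 using sc by algebra
    moreover have "d2 (d2 X) (u, \<theta>) \<bullet> n = (R u)\<^sup>2 * L1 u"
      unfolding D2 n inner_vec3 using sc by algebra
    moreover have "d2 (d1 X) (u, \<theta>) \<bullet> n = - (h * (R1 u)\<^sup>2)"
      unfolding D2 n inner_vec3 using sc by algebra
    moreover have "n \<bullet> vector [0, 0, 1] = A u"
      by (simp add: n inner_vec3 A[OF u] R1_def)
    ultimately have "gauss_curvature X (u, \<theta>) = angle_function X (u, \<theta>) ^ 4 \<longleftrightarrow>
      R u * (R1 u * L2 u - R2 u * L1 u) * ((R u)\<^sup>2 * L1 u) - (- (h * (R1 u)\<^sup>2))\<^sup>2 = A u ^ 4"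
      using K14_condition_iff[of X "(u, \<theta>)"] reg[OF u, of \<theta>] pos by (simp add: n_def)
    \<comment> \<open>Here the pitch disappears: the numerator of the curvature contains h
      explicitly, while the right side involves only A, w and their derivatives.\<close>
    moreover have "R u * (R1 u * L2 u - R2 u * L1 u) * ((R u)\<^sup>2 * L1 u) - (- (h * (R1 u)\<^sup>2))\<^sup>2
      = A u * w' u / 2 - A' u * w u"
    proof -
      have "2 * (R u * (R1 u * L2 u - R2 u * L1 u) * ((R u)\<^sup>2 * L1 u) - (- (h * (R1 u)\<^sup>2))\<^sup>2)
        = A u * w' u - 2 * A' u * w u"
        unfolding w1 A1 A(1)[OF u] w(1)[OF u] R1_def[symmetric] L1_def[symmetric] by algebra
      then show ?thesis by simp
    qed
    ultimately show ?thesis by simp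
  qed
  show ?thesis
    unfolding K14_patch_def regular_patch_def X_def[symmetric]
    using reg K smooth_on_helicoidal_map[OF assms(1-3), of h] assms(1)
    by (auto simp: X_def open_Times)
qed

section \<open>Bour's isometric deformation\<close>

text \<open>It moves the starting point along each screw orbit and maps every orbit (u constant) to
  itself.\<close>

definition shear :: "(real \<Rightarrow> real) \<Rightarrow> real \<times> real \<Rightarrow> real \<times> real" where
  "shear \<psi> = (\<lambda>(u, t). (u, t + \<psi> u))"

lemma smooth_on_shear:
  assumes "open I" "smooth_on I \<psi>"
  shows "smooth_on (I \<times> UNIV) (shear \<psi>)"
proof -
  have op: "open (I \<times> (UNIV :: real set))" using assms(1) by (auto intro: open_Times)
  have "smooth_on (I \<times> UNIV) (\<lambda>p::real \<times> real. \<psi> (fst p))"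
    using smooth_on_compose[OF op assms(1) _ assms(2) smooth_on_fst_snd(1)[OF op]] by auto
  then show ?thesis
    unfolding shear_def case_prod_beta' by (intro smooth_intros op smooth_on_fst_snd)
qed

lemma diffeo_shear:
  assumes "open I" "smooth_on I \<psi>"
  shows "diffeo (I \<times> UNIV) (I \<times> UNIV) (shear \<psi>)"
proof -
  have sm: "smooth_on (I \<times> UNIV) (shear \<psi>)" "smooth_on (I \<times> UNIV) (shear (\<lambda>u. - \<psi> u))"
    using assms by (auto intro: smooth_on_shear smooth_on_uminus)
  have "homeomorphism (I \<times> UNIV) (I \<times> UNIV) (shear \<psi>) (shear (\<lambda>u. - \<psi> u))"
    by (rule homeomorphismI)
      (use sm in \<open>auto intro: smooth_on_imp_continuous_on simp: shear_def\<close>)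
  then show ?thesis
    using sm assms(1) by (auto simp: diffeo_def open_Times)
qed

text \<open>The shear replaces the first partial by itself plus \<psi>' times the second and keeps
  the second. The cross product is therefore unchanged, and with it the normal.\<close>

lemma shear_fundamental_forms:
  assumes "X differentiable (at (u, t + \<psi> u))" "(\<psi> has_real_derivative \<psi>') (at u)"
  shows "ff_E (X \<circ> shear \<psi>) (u, t)
      = ff_E X (u, t + \<psi> u) + 2 * \<psi>' * ff_F X (u, t + \<psi> u) + \<psi>'\<^sup>2 * ff_G X (u, t + \<psi> u)"
    "ff_F (X \<circ> shear \<psi>) (u, t) = ff_F X (u, t + \<psi> u) + \<psi>' * ff_G X (u, t + \<psi> u)"
    "ff_G (X \<circ> shear \<psi>) (u, t) = ff_G X (u, t + \<psi> u)"
    "angle_function (X \<circ> shear \<psi>) (u, t) = angle_function X (u, t + \<psi> u)"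
proof -
  let ?X' = "frechet_derivative X (at (u, t + \<psi> u))"
  have X: "(X has_derivative ?X') (at (shear \<psi> (u, t)))"
    using assms(1) by (simp add: frechet_derivative_works[symmetric] shear_def)
  have "((\<lambda>p. \<psi> (fst p)) has_derivative (\<lambda>v. \<psi>' * fst v)) (at (u, t))"
    using has_derivative_compose[OF has_derivative_fst[OF has_derivative_ident], of \<psi> "(*) \<psi>'" "(u, t)"] assms(2)
    by (simp add: has_field_derivative_def)
  then have "(shear \<psi> has_derivative (\<lambda>v. (fst v, snd v + \<psi>' * fst v))) (at (u, t))"
    unfolding shear_def case_prod_beta' by (auto intro!: derivative_eq_intros)
  from has_derivative_compose[OF this X]
  have "(X \<circ> shear \<psi> has_derivative (\<lambda>v. ?X' (fst v, snd v + \<psi>' * fst v))) (at (u, t))"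
    by (simp add: o_def)
  note d = d_eqI[OF this]
  have lin: "linear ?X'"
    using has_derivative_linear[OF X] by (simp add: shear_def)
  have "?X' ((1, 0) + \<psi>' *\<^sub>R (0, 1)) = ?X' (1, 0) + \<psi>' *\<^sub>R ?X' (0, 1)"
    by (simp only: linear_add[OF lin] linear_scale[OF lin])
  then have "?X' (1, \<psi>') = ?X' (1, 0) + \<psi>' *\<^sub>R ?X' (0, 1)"
    by simp
  then have d1: "d1 (X \<circ> shear \<psi>) (u, t) = d1 X (u, t + \<psi> u) + \<psi>' *\<^sub>R d2 X (u, t + \<psi> u)"
    using d(1) by (simp add: d1_def d2_def)
  have d2: "d2 (X \<circ> shear \<psi>) (u, t) = d2 X (u, t + \<psi> u)"
    using d(2) by (simp add: d2_def)
  show "ff_E (X \<circ> shear \<psi>) (u, t)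
      = ff_E X (u, t + \<psi> u) + 2 * \<psi>' * ff_F X (u, t + \<psi> u) + \<psi>'\<^sup>2 * ff_G X (u, t + \<psi> u)"
    "ff_F (X \<circ> shear \<psi>) (u, t) = ff_F X (u, t + \<psi> u) + \<psi>' * ff_G X (u, t + \<psi> u)"
    "ff_G (X \<circ> shear \<psi>) (u, t) = ff_G X (u, t + \<psi> u)"
    unfolding ff_E_def ff_F_def ff_G_def d1 d2
    by (simp_all add: inner_add inner_commute power2_eq_square algebra_simps)
  have "cross3 (d1 (X \<circ> shear \<psi>) (u, t)) (d2 (X \<circ> shear \<psi>) (u, t))
      = cross3 (d1 X (u, t + \<psi> u)) (d2 X (u, t + \<psi> u))"
    unfolding d1 d2 by (simp add: cross_add_left cross_mult_left cross_refl)
  then show "angle_function (X \<circ> shear \<psi>) (u, t) = angle_function X (u, t + \<psi> u)"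
    by (simp add: angle_function_def unit_normal_def)
qed

text \<open>By the intermediate value theorem. It recovers R and L' of a given translator from their
  squares, which is all that the Bour data determine.\<close>

lemma nonzero_constant_sign:
  fixes f :: "real \<Rightarrow> real"
  assumes "is_interval I" "continuous_on I f" "\<And>u. u \<in> I \<Longrightarrow> f u \<noteq> 0"
  obtains \<sigma> where "\<sigma> \<in> {1, -1}" "\<And>u. u \<in> I \<Longrightarrow> f u = \<sigma> * \<bar>f u\<bar>"
proof -
  have conn: "connected (f ` I)"
    using connected_continuous_image assms(1,2) is_interval_connected by blast
  have "(\<forall>u\<in>I. f u > 0) \<or> (\<forall>u\<in>I. f u < 0)"
  proof (rule ccontr)
    assume "\<not> ?thesis"
    then obtain u v where "u \<in> I" "v \<in> I" "f u < 0" "f v > 0"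
      using assms(3) by (metis linorder_neqE_linordered_idom)
    then have "0 \<in> f ` I"
      using connectedD_interval[OF conn, of "f u" "f v" 0] by auto
    then show False using assms(3) by auto
  qed
  then show ?thesis
  proof
    assume "\<forall>u\<in>I. f u > 0" then show ?thesis using that[of 1] by force
  next
    assume "\<forall>u\<in>I. f u < 0" then show ?thesis using that[of "-1"] by force
  qed
qed

text \<open>The data shared by all members of a Bour family: \<open>g = G\<close>, \<open>A = G'/2\<close> and
  \<open>w = E G - F\<^sup>2\<close>.\<close>

locale bour_data =
  fixes I :: "real set" and g A w :: "real \<Rightarrow> real"
  assumes open_I: "open I" and interval_I: "is_interval I" and nonempty_I: "I \<noteq> {}"
    and smooth_g: "smooth_on I g" and smooth_w: "smooth_on I w"
    and g_pos: "u \<in> I \<Longrightarrow> g u > 0" and w_pos: "u \<in> I \<Longrightarrow> w u > 0"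
    and g_deriv: "u \<in> I \<Longrightarrow> (g has_real_derivative 2 * A u) (at u)"
    and curvature_eq: "u \<in> I \<Longrightarrow> A u * deriv w u / 2 - deriv A u * w u = A u ^ 4"
begin

text \<open>The generating curves of pitch h whose patch has G = g, vertical component A of the
  unnormalized normal, and E G - F^2 = w.\<close>

definition realizes :: "real \<Rightarrow> (real \<Rightarrow> real) \<Rightarrow> (real \<Rightarrow> real) \<Rightarrow> bool" where
  "realizes h R L \<longleftrightarrow> smooth_on I R \<and> smooth_on I L \<and>
     (\<forall>u\<in>I. (R u)\<^sup>2 + h\<^sup>2 = g u \<and> R u * deriv R u = A u \<and>
        g u * (deriv R u)\<^sup>2 + (deriv L u)\<^sup>2 * (R u)\<^sup>2 = w u)"

text \<open>For a curve that realizes the data with pitch h this is (R^2 L')^2: multiply the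
  equation for w by R^2 = g - h^2 and replace (R R')^2 by A^2. So \<open>slope\<close> is the
  absolute value of L'.\<close>

definition disc :: "real \<Rightarrow> real \<Rightarrow> real" where
  "disc h u = w u * (g u - h\<^sup>2) - (A u)\<^sup>2 * g u"

definition slope :: "real \<Rightarrow> real \<Rightarrow> real" where
  "slope h u = sqrt (disc h u) / (g u - h\<^sup>2)"

lemma smooth_A: "smooth_on I A"
proof (rule smooth_on_cong[OF open_I])
  show "smooth_on I (\<lambda>u. deriv g u * (1/2))"
    by (intro smooth_intros open_I smooth_on_deriv smooth_g)
  show "deriv g u * (1/2) = A u" if "u \<in> I" for u
    using DERIV_imp_deriv[OF g_deriv[OF that]] by simp
qed

lemma realizes_translator:
  assumes "realizes h R L"
  shows "helicoidal_translator h I R L"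
proof -
  have "K14_patch (I \<times> UNIV) (helicoidal_map h R L)"
  proof (subst K14_helicoidal_iff[OF open_I, where A = A and w = w])
    show "(A has_real_derivative deriv A u) (at u)" "(w has_real_derivative deriv w u) (at u)" if "u \<in> I" for u
      using that smooth_on_deriv(1)[OF open_I] smooth_A smooth_w by auto
  qed (use assms w_pos curvature_eq in \<open>auto simp: realizes_def\<close>)
  then show ?thesis
    using assms open_I interval_I nonempty_I by (auto simp: helicoidal_translator_def realizes_def)
qed

lemma realizes_forms:
  assumes "realizes h R L" "u \<in> I"
  shows "g u * ff_E (helicoidal_map h R L) (u, \<theta>) = w u + (h * deriv L u)\<^sup>2"
    "ff_F (helicoidal_map h R L) (u, \<theta>) = h * deriv L u"
    "ff_G (helicoidal_map h R L) (u, \<theta>) = g u"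
    "angle_function (helicoidal_map h R L) (u, \<theta>) = A u / sqrt (w u)"
    "helicoidal_map h R L differentiable (at (u, \<theta>))"
proof -
  have sm: "smooth_on I R" "smooth_on I L" using assms by (auto simp: realizes_def)
  have r: "(R u)\<^sup>2 + h\<^sup>2 = g u" "R u * deriv R u = A u" "g u * (deriv R u)\<^sup>2 + (deriv L u)\<^sup>2 * (R u)\<^sup>2 = w u"
    using assms by (auto simp: realizes_def)
  note forms = helicoidal_fundamental_forms[OF open_I assms(2) sm, of h \<theta>]
  show "ff_F (helicoidal_map h R L) (u, \<theta>) = h * deriv L u"
    "ff_G (helicoidal_map h R L) (u, \<theta>) = g u"
    "angle_function (helicoidal_map h R L) (u, \<theta>) = A u / sqrt (w u)"
    using forms r by simp_all
  show "g u * ff_E (helicoidal_map h R L) (u, \<theta>) = w u + (h * deriv L u)\<^sup>2"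
    unfolding forms r(3)[symmetric] r(1)[symmetric] by algebra
  have "smooth_on (I \<times> UNIV) (helicoidal_map h R L)"
    using smooth_on_helicoidal_map open_I sm by blast
  then show "helicoidal_map h R L differentiable (at (u, \<theta>))"
    using assms(2) Ck_on.simps(2)[of 0 "I \<times> UNIV" "helicoidal_map h R L"] by (auto simp: smooth_on_def)
qed

text \<open>A shear keeps G and E G - F^2 and adds \<psi>' g to F. Thus F can be prescribed by a
  single integration, and E is then forced by w.\<close>

lemma realizes_shear:
  assumes "realizes h R L" "u \<in> I" "(\<psi> has_real_derivative \<psi>') (at u)"
  defines "Y \<equiv> helicoidal_map h R L \<circ> shear \<psi>"
  shows "g u * ff_E Y (u, t) = w u + (h * deriv L u + \<psi>' * g u)\<^sup>2"
    "ff_F Y (u, t) = h * deriv L u + \<psi>' * g u"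
    "ff_G Y (u, t) = g u"
    "angle_function Y (u, t) = A u / sqrt (w u)"
proof -
  note f = realizes_forms[OF assms(1,2), of "t + \<psi> u"]
  note s = shear_fundamental_forms[OF f(5) assms(3)]
  have "g u * ff_E Y (u, t) = g u * ff_E (helicoidal_map h R L) (u, t + \<psi> u)
      + 2 * \<psi>' * (h * deriv L u) * g u + \<psi>'\<^sup>2 * (g u)\<^sup>2"
    unfolding Y_def s f(2,3) by algebra
  then show "g u * ff_E Y (u, t) = w u + (h * deriv L u + \<psi>' * g u)\<^sup>2"
    unfolding f(1) by algebra
  show "ff_F Y (u, t) = h * deriv L u + \<psi>' * g u" "ff_G Y (u, t) = g u"
    "angle_function Y (u, t) = A u / sqrt (w u)"
    by (simp_all add: Y_def s f)
qed

lemma antiderivative_ex: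
  assumes "smooth_on I f"
  obtains F where "\<And>u. u \<in> I \<Longrightarrow> (F has_real_derivative f u) (at u)" "smooth_on I F"
proof -
  obtain b where b: "b \<in> I" using nonempty_I by auto
  show ?thesis
    using that[of "antideriv_from b f"] smooth_on_antiderivative[OF open_I _ assms]
      antideriv_from_has_derivative[OF open_I interval_I b smooth_on_imp_continuous_on[OF assms]]
    by blast
qed

lemma smooth_on_screw_rate:
  assumes "realizes h R L"
  shows "smooth_on I (\<lambda>u. h * deriv L u / g u)"
  by (intro smooth_intros open_I smooth_on_deriv smooth_g)
    (use assms g_pos in \<open>force simp: realizes_def\<close>)+

text \<open>The derivative f of the shear is the difference of the two quotients F / G, so the
  sheared second patch has the same F as the first. G and w already agree, hence so does E.\<close>

lemma realizes_isometric:
  assumes "realizes h R L" "realizes k S M"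
  shows "isometric_patches (I \<times> UNIV) (helicoidal_map h R L) (I \<times> UNIV) (helicoidal_map k S M)"
proof -
  define f where "f u = h * deriv L u / g u - k * deriv M u / g u" for u
  have "smooth_on I f"
    unfolding f_def
    by (intro smooth_on_diff open_I smooth_on_screw_rate[OF assms(1)] smooth_on_screw_rate[OF assms(2)])
  then obtain \<psi> where \<psi>: "\<And>u. u \<in> I \<Longrightarrow> (\<psi> has_real_derivative f u) (at u)" "smooth_on I \<psi>"
    using antiderivative_ex by metis
  have "ff_E (helicoidal_map h R L) p = ff_E (helicoidal_map k S M \<circ> shear \<psi>) p \<and>
      ff_F (helicoidal_map h R L) p = ff_F (helicoidal_map k S M \<circ> shear \<psi>) p \<and>
      ff_G (helicoidal_map h R L) p = ff_G (helicoidal_map k S M \<circ> shear \<psi>) p" if mem: "p \<in> I \<times> UNIV" for p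
  proof -
    obtain u t where p: "p = (u, t)" and u: "u \<in> I" using mem by auto
    note X = realizes_forms[OF assms(1) u, of t] and Y = realizes_shear[OF assms(2) u \<psi>(1)[OF u], of t]
    have g: "g u > 0" using g_pos[OF u] .
    then have eq: "k * deriv M u + f u * g u = h * deriv L u"
      by (simp add: f_def field_simps)
    then have "g u * ff_E (helicoidal_map h R L) p = g u * ff_E (helicoidal_map k S M \<circ> shear \<psi>) p"
      using X(1) Y(1) by (simp add: p)
    then have "ff_E (helicoidal_map h R L) p = ff_E (helicoidal_map k S M \<circ> shear \<psi>) p"
      using g by simp
    then show ?thesis using X(2,3) Y(2,3) eq by (simp add: p)
  qed
  then show ?thesis
    unfolding isometric_patches_def using diffeo_shear[OF open_I \<psi>(2)] by blast
qed

text \<open>Positivity of the radicand forces w (g - h^2) > A^2 g >= 0. So one hypothesis on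
  \<open>disc\<close> makes both R and the slope well defined and smooth.\<close>

lemma disc_pos_imp_gap:
  assumes "u \<in> I" "disc h u > 0"
  shows "g u > h\<^sup>2"
proof -
  have "w u * (g u - h\<^sup>2) > 0"
    using assms(2) g_pos[OF assms(1)] unfolding disc_def
    by (smt (verit) mult_nonneg_nonneg zero_le_power2)
  then show ?thesis using w_pos[OF assms(1)] by (simp add: zero_less_mult_iff)
qed

lemma smooth_on_slope:
  assumes "\<And>u. u \<in> I \<Longrightarrow> disc h u > 0"
  shows "smooth_on I (slope h)"
proof -
  have "smooth_on I (disc h)"
    unfolding disc_def by (intro smooth_intros open_I smooth_g smooth_w smooth_A)
  then show ?thesis
    unfolding slope_def
    by (intro smooth_intros open_I smooth_g) (use assms disc_pos_imp_gap in fastforce)+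
qed

text \<open>The data fix R and L' only up to sign. Both signs stay free here so that the deformation
  can later be made to pass through a given curve.\<close>

lemma realizes_bour:
  assumes disc: "\<And>u. u \<in> I \<Longrightarrow> disc h u > 0" and sgn: "\<sigma> \<in> {1, -1}" "\<tau> \<in> {1, -1}"
    and L: "\<And>u. u \<in> I \<Longrightarrow> (L has_real_derivative \<tau> * slope h u) (at u)"
  shows "realizes h (\<lambda>u. \<sigma> * sqrt (g u - h\<^sup>2)) L"
proof -
  define R where "R u = \<sigma> * sqrt (g u - h\<^sup>2)" for u
  have gap: "g u - h\<^sup>2 > 0" if "u \<in> I" for u
    using disc_pos_imp_gap[OF that disc[OF that]] by simp
  have smR: "smooth_on I R"
    unfolding R_def by (intro smooth_intros open_I smooth_g) (use gap in auto)
  have smL: "smooth_on I L"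
    by (rule smooth_on_antiderivative[OF open_I L])
      (auto intro!: smooth_intros open_I smooth_on_slope disc)
  have "(R u)\<^sup>2 + h\<^sup>2 = g u \<and> R u * deriv R u = A u \<and> g u * (deriv R u)\<^sup>2 + (deriv L u)\<^sup>2 * (R u)\<^sup>2 = w u"
    if u: "u \<in> I" for u
  proof -
    have R2: "(R v)\<^sup>2 = g v - h\<^sup>2" if "v \<in> I" for v
      using gap[OF that] sgn(1) by (auto simp: R_def power_mult_distrib)
    have Rd: "(R has_real_derivative deriv R u) (at u)"
      using smooth_on_deriv(1)[OF open_I smR u] .
    have "((\<lambda>v. (R v)\<^sup>2) has_real_derivative 2 * A u) (at u)"
    proof (rule has_field_derivative_transform_within_open[OF _ open_I u])
      show "((\<lambda>v. g v - h\<^sup>2) has_real_derivative 2 * A u) (at u)"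
        using g_deriv[OF u] by (auto intro!: derivative_eq_intros)
    qed (use R2 in auto)
    moreover have "((\<lambda>v. (R v)\<^sup>2) has_real_derivative 2 * (R u * deriv R u)) (at u)"
      using Rd by (auto intro!: derivative_eq_intros)
    ultimately have RA: "R u * deriv R u = A u"
      using DERIV_unique by fastforce
    have "deriv L u = \<tau> * slope h u"
      using DERIV_imp_deriv[OF L[OF u]] .
    then have "(deriv L u)\<^sup>2 = (slope h u)\<^sup>2"
      using sgn(2) by (auto simp: power_mult_distrib)
    also have "\<dots> = disc h u / (g u - h\<^sup>2)\<^sup>2"
      using disc[OF u] by (simp add: slope_def power_divide)
    finally have "(deriv L u)\<^sup>2 * ((R u)\<^sup>2)\<^sup>2 = disc h u"
      using gap[OF u] by (simp add: R2[OF u])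
    \<comment> \<open>The equation for w is checked after multiplication by R^2, where R' enters
      only through (R R')^2 = A^2; the nonzero factor is cancelled afterwards.\<close>
    then have "(R u)\<^sup>2 * (g u * (deriv R u)\<^sup>2 + (deriv L u)\<^sup>2 * (R u)\<^sup>2) = (R u)\<^sup>2 * w u"
      using RA R2[OF u] unfolding disc_def by algebra
    moreover have "(R u)\<^sup>2 \<noteq> 0" using gap[OF u] R2[OF u] by simp
    ultimately show ?thesis using RA R2[OF u] by simp
  qed
  then show ?thesis
    using smR smL unfolding realizes_def R_def[abs_def] by auto
qed

lemma continuous_on_slope:
  assumes "\<And>h u. h \<in> J \<Longrightarrow> u \<in> I \<Longrightarrow> disc h u > 0"
  shows "continuous_on (J \<times> I) (\<lambda>(h, u). slope h u)"
proof -
  have c: "continuous_on (J \<times> I) (\<lambda>p. f (snd p))" if "smooth_on I f" for f :: "real \<Rightarrow> real"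
    by (rule continuous_on_compose2[OF smooth_on_imp_continuous_on[OF that]]) (auto intro: continuous_intros)
  show ?thesis
    unfolding slope_def disc_def case_prod_beta'
    by (intro continuous_intros c smooth_g smooth_w smooth_A)
      (use disc_pos_imp_gap assms in fastforce)
qed

lemma isometric_family:
  assumes R: "realizes \<mu> R L" and J: "\<mu> \<in> J" "0 \<in> J"
    and disc: "\<And>h u. h \<in> J \<Longrightarrow> u \<in> I \<Longrightarrow> disc h u > 0"
  shows "\<exists>Rf Lf. isometric_translator_family \<mu> I R L J Rf Lf"
proof -
  have sm: "smooth_on I R" "smooth_on I L" using R by (auto simp: realizes_def)
  have Req: "(R u)\<^sup>2 = g u - \<mu>\<^sup>2" and Leq: "(deriv L u)\<^sup>2 * ((R u)\<^sup>2)\<^sup>2 = disc \<mu> u" if u: "u \<in> I" for u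
  proof -
    have r: "(R u)\<^sup>2 + \<mu>\<^sup>2 = g u" "R u * deriv R u = A u" "g u * (deriv R u)\<^sup>2 + (deriv L u)\<^sup>2 * (R u)\<^sup>2 = w u"
      using R u by (auto simp: realizes_def)
    then show R2: "(R u)\<^sup>2 = g u - \<mu>\<^sup>2" by simp
    show "(deriv L u)\<^sup>2 * ((R u)\<^sup>2)\<^sup>2 = disc \<mu> u"
      unfolding disc_def r(2,3)[symmetric] R2[symmetric] by algebra
  qed
  have "R u \<noteq> 0" and "deriv L u \<noteq> 0" if "u \<in> I" for u
    using Req[OF that] Leq[OF that] disc[OF J(1) that] disc_pos_imp_gap[OF that disc[OF J(1) that]] by auto
  then obtain \<sigma> \<tau> where \<sigma>: "\<sigma> \<in> {1, -1}" "\<And>u. u \<in> I \<Longrightarrow> R u = \<sigma> * \<bar>R u\<bar>"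
    and \<tau>: "\<tau> \<in> {1, -1}" "\<And>u. u \<in> I \<Longrightarrow> deriv L u = \<tau> * \<bar>deriv L u\<bar>"
    using nonzero_constant_sign[OF interval_I] smooth_on_imp_continuous_on[OF sm(1)]
      smooth_on_imp_continuous_on[OF smooth_on_deriv(2)[OF open_I sm(2)]] by metis
  obtain b where b: "b \<in> I" using nonempty_I by auto
  define Rf where "Rf h u = \<sigma> * sqrt (g u - h\<^sup>2)" for h u
  \<comment> \<open>All members share the height \<open>L b\<close> at the base point b. Together
    with the signs this makes the member at pitch \<mu> equal to the given curve.\<close>
  define Lf where "Lf h u = L b + antideriv_from b (\<lambda>x. \<tau> * slope h x) u" for h u
  have real: "realizes h (Rf h) (Lf h)" if h: "h \<in> J" for h
    unfolding Rf_def
  proof (rule realizes_bour[OF disc[OF h] \<sigma>(1) \<tau>(1)])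
    fix u assume u: "u \<in> I"
    have "continuous_on I (\<lambda>x. \<tau> * slope h x)"
      by (intro continuous_intros smooth_on_imp_continuous_on smooth_on_slope disc h)
    from antideriv_from_has_derivative[OF open_I interval_I b this u]
    show "(Lf h has_real_derivative \<tau> * slope h u) (at u)"
      unfolding Lf_def by (auto intro!: derivative_eq_intros)
  qed
  have "Rf \<mu> u = R u" "Lf \<mu> u = L u" if u: "u \<in> I" for u
  proof -
    show "Rf \<mu> u = R u"
      using \<sigma>(2)[OF u] by (simp add: Rf_def Req[OF u, symmetric])
    have "\<tau> * slope \<mu> x = deriv L x" if x: "x \<in> I" for x
    proof -
      have "g x - \<mu>\<^sup>2 > 0" using disc_pos_imp_gap[OF x disc[OF J(1) x]] by simp
      then have "slope \<mu> x = \<bar>deriv L x\<bar>"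
        by (simp add: slope_def Leq[OF x, symmetric] Req[OF x] real_sqrt_mult)
      then show ?thesis using \<tau>(2)[OF x] by simp
    qed
    then have "(L has_real_derivative \<tau> * slope \<mu> x) (at x within I)" if "x \<in> I" for x
      using smooth_on_deriv(1)[OF open_I sm(2) that] that has_field_derivative_at_within by fastforce
    from antideriv_from_eq[OF interval_I b u this] show "Lf \<mu> u = L u"
      by (simp add: Lf_def)
  qed
  moreover have "continuous_on (J \<times> I) (\<lambda>(h, u). (Rf h u, Lf h u))"
  proof -
    have g: "continuous_on (J \<times> I) (\<lambda>p. g (snd p))"
      by (rule continuous_on_compose2[OF smooth_on_imp_continuous_on[OF smooth_g]]) (auto intro: continuous_intros)
    have "continuous_on ((J \<times> I) \<times> I) (\<lambda>p. (\<lambda>(h, u). slope h u) (fst (fst p), snd p))"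
      by (rule continuous_on_compose2[OF continuous_on_slope[OF disc]]) (auto intro!: continuous_intros)
    then have "continuous_on ((J \<times> I) \<times> I) (\<lambda>(s, x). \<tau> * slope (fst s) x)"
      unfolding case_prod_beta' by (auto intro!: continuous_intros)
    then have "continuous_on (J \<times> I) (\<lambda>s. antideriv_from b (\<lambda>x. \<tau> * slope (fst s) x) (snd s))"
      by (rule continuous_on_antideriv_from[rotated 2])
        (auto intro!: continuous_intros segment_in_interval[OF interval_I b])
    then show ?thesis
      unfolding Rf_def Lf_def case_prod_beta' by (intro continuous_intros g)
  qed
  ultimately have "isometric_translator_family \<mu> I R L J Rf Lf"
    unfolding isometric_translator_family_def
    using J realizes_translator[OF real] realizes_isometric[OF real R]
    by (auto simp: helicoidal_map_def)
  then show ?thesis by blast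
qed

end

section \<open>Deforming an arbitrary helicoidal translator\<close>

lemma helicoidal_translator_subset:
  assumes "helicoidal_translator \<mu> I R L" "J \<subseteq> I" "open J" "is_interval J" "J \<noteq> {}"
  shows "helicoidal_translator \<mu> J R L"
  using assms K14_patch_subset[of "I \<times> UNIV" "helicoidal_map \<mu> R L" "J \<times> UNIV"]
  by (auto simp: helicoidal_translator_def open_Times Sigma_mono intro: smooth_on_subset)

text \<open>The nonvanishing of R and L' is extracted from the curvature equation. On the axis A =
  0, so the equation leaves R'^2 w = 0; then R' = 0 and w = 0, against regularity.\<close>

lemma translator_bour_data:
  fixes R L \<mu>
  assumes "helicoidal_translator \<mu> I R L"
  defines "g \<equiv> \<lambda>u. (R u)\<^sup>2 + \<mu>\<^sup>2" and "A \<equiv> \<lambda>u. R u * deriv R u"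
    and "w \<equiv> \<lambda>u. ((R u)\<^sup>2 + \<mu>\<^sup>2) * (deriv R u)\<^sup>2 + (deriv L u)\<^sup>2 * (R u)\<^sup>2"
  shows "bour_data I g A w" "bour_data.realizes I g A w \<mu> R L"
    "\<And>u. u \<in> I \<Longrightarrow> bour_data.disc g A w \<mu> u > 0"
proof -
  have I: "open I" "is_interval I" "I \<noteq> {}" and sm: "smooth_on I R" "smooth_on I L"
    and K: "K14_patch (I \<times> UNIV) (helicoidal_map \<mu> R L)"
    using assms(1) by (auto simp: helicoidal_translator_def)
  define R1 R2 L1 L2 where "R1 = deriv R" and "R2 = deriv R1" and "L1 = deriv L" and "L2 = deriv L1"
  have D: "(R has_real_derivative R1 u) (at u)" "(R1 has_real_derivative R2 u) (at u)"
    "(L has_real_derivative L1 u) (at u)" "(L1 has_real_derivative L2 u) (at u)" if "u \<in> I" for u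
    using that smooth_on_deriv[OF I(1) sm(1)] smooth_on_deriv[OF I(1) sm(2)] smooth_on_deriv(1)[OF I(1)]
    by (auto simp: R1_def R2_def L1_def L2_def)
  have smooth: "smooth_on I g" "smooth_on I A" "smooth_on I w"
    unfolding g_def A_def w_def by (intro smooth_intros smooth_on_deriv sm I(1))+
  have A': "deriv A u = (R1 u)\<^sup>2 + R u * R2 u"
    and w': "deriv w u = 2 * R u * R1 u * (R1 u)\<^sup>2 + ((R u)\<^sup>2 + \<mu>\<^sup>2) * (2 * R1 u * R2 u)
        + 2 * L1 u * L2 u * (R u)\<^sup>2 + (L1 u)\<^sup>2 * (2 * R u * R1 u)" if "u \<in> I" for u
    using area_form_derivatives[OF D[OF that]] unfolding A_def w_def R1_def L1_def
    by (auto intro!: DERIV_imp_deriv)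
  have eq: "w u > 0" "A u * deriv w u / 2 - deriv A u * w u = A u ^ 4" if "u \<in> I" for u
    using K14_helicoidal_iff[OF I(1) sm, of A "deriv A" w \<mu> "deriv w"] K that
      smooth_on_deriv(1)[OF I(1) smooth(2)] smooth_on_deriv(1)[OF I(1) smooth(3)]
    by (auto simp: A_def w_def)
  have nz: "R u \<noteq> 0" "L1 u \<noteq> 0" if u: "u \<in> I" for u
  proof -
    show R: "R u \<noteq> 0"
    proof
      assume "R u = 0"
      then show False
        using eq[OF u] A'[OF u] by (auto simp: A_def w_def R1_def)
    qed
    show "L1 u \<noteq> 0"
    proof
      \<comment> \<open>Where L' = 0 the numerator of the curvature is -(\<mu> R'^2)^2, while the
        translator equation demands (R R')^4. Hence R'^4 (R^4 + \<mu>^2) = 0, although R' is nonzero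
        by regularity.\<close>
      assume L: "L1 u = 0"
      then have "R1 u \<noteq> 0" using eq(1)[OF u] by (auto simp: w_def R1_def L1_def)
      have "2 * (A u ^ 4) = A u * deriv w u - 2 * deriv A u * w u"
        using eq(2)[OF u] by simp
      then have "(R1 u) ^ 4 * ((R u) ^ 4 + \<mu>\<^sup>2) = 0"
        using L unfolding w'[OF u] A'[OF u] unfolding A_def w_def R1_def[symmetric] L1_def[symmetric]
        by algebra
      moreover have "(R u) ^ 4 + \<mu>\<^sup>2 > 0" using R by (simp add: add_pos_nonneg)
      ultimately show False using \<open>R1 u \<noteq> 0\<close> by simp
    qed
  qed
  show bd: "bour_data I g A w"
  proof
    show "(g has_real_derivative 2 * A u) (at u)" if "u \<in> I" for u
      using D(1)[OF that] unfolding g_def A_def R1_def by (auto intro!: derivative_eq_intros)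
    show "g u > 0" if "u \<in> I" for u using nz(1)[OF that] by (simp add: g_def add_pos_nonneg)
  qed (use I smooth eq in auto)
  show "bour_data.realizes I g A w \<mu> R L"
    unfolding bour_data.realizes_def[OF bd] using sm by (auto simp: g_def A_def w_def)
  show "bour_data.disc g A w \<mu> u > 0" if u: "u \<in> I" for u
  proof -
    have "bour_data.disc g A w \<mu> u = (L1 u)\<^sup>2 * ((R u)\<^sup>2)\<^sup>2"
      unfolding bour_data.disc_def[OF bd] unfolding g_def A_def w_def L1_def by algebra
    then show ?thesis using nz[OF u] by simp
  qed
qed

lemma deformation_closed:
  assumes "helicoidal_translator \<mu> I R L"
  shows "\<exists>Rf Lf. isometric_translator_family \<mu> I R L {-\<bar>\<mu>\<bar>..\<bar>\<mu>\<bar>} Rf Lf"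
proof -
  note bd = translator_bour_data[OF assms]
  show ?thesis
  proof (rule bour_data.isometric_family[OF bd(1,2)])
    fix h u assume h: "h \<in> {-\<bar>\<mu>\<bar>..\<bar>\<mu>\<bar>}" and u: "u \<in> I"
    have "h\<^sup>2 \<le> \<mu>\<^sup>2" using h by (auto simp: abs_le_square_iff[symmetric])
    then show "0 < bour_data.disc (\<lambda>u. (R u)\<^sup>2 + \<mu>\<^sup>2) (\<lambda>u. R u * deriv R u)
        (\<lambda>u. ((R u)\<^sup>2 + \<mu>\<^sup>2) * (deriv R u)\<^sup>2 + (deriv L u)\<^sup>2 * (R u)\<^sup>2) h u"
      using bd(3)[OF u] bour_data.w_pos[OF bd(1) u] mult_left_mono[of "h\<^sup>2" "\<mu>\<^sup>2"]
      unfolding bour_data.disc_def[OF bd(1)] by (smt (verit) mult_left_mono)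
  qed auto
qed

text \<open>Changing the pitch from \<mu> to h lowers the radicand by w (h^2 - \<mu>^2). On the
  compact interval the radicand at \<mu> has a positive minimum and w has a maximum; their quotient
  \<delta> is an admissible increase of the squared pitch.\<close>

lemma deformation_open:
  assumes "helicoidal_translator \<mu> I R L" and ab: "a < b" "{a..b} \<subseteq> I"
  shows "\<exists>\<epsilon>>0. \<exists>Rf Lf. isometric_translator_family \<mu> {a<..<b} R L {-(\<bar>\<mu>\<bar> + \<epsilon>)<..<\<bar>\<mu>\<bar> + \<epsilon>} Rf Lf"
proof -
  define g A w where "g = (\<lambda>u. (R u)\<^sup>2 + \<mu>\<^sup>2)" and "A = (\<lambda>u. R u * deriv R u)"
    and "w = (\<lambda>u. ((R u)\<^sup>2 + \<mu>\<^sup>2) * (deriv R u)\<^sup>2 + (deriv L u)\<^sup>2 * (R u)\<^sup>2)"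
  note bd = translator_bour_data[OF assms(1), folded g_def A_def w_def]
  have "helicoidal_translator \<mu> {a<..<b} R L"
    by (rule helicoidal_translator_subset[OF assms(1)]) (use ab in \<open>auto simp: is_interval_oo\<close>)
  note bd' = translator_bour_data[OF this, folded g_def A_def w_def]
  have disc: "bour_data.disc g A w h u = w u * (g u - h\<^sup>2) - (A u)\<^sup>2 * g u" for h u
    by (rule bour_data.disc_def[OF bd(1)])
  have "continuous_on {a..b} f" if "smooth_on I f" for f :: "real \<Rightarrow> real"
    using continuous_on_subset[OF smooth_on_imp_continuous_on[OF that] ab(2)] .
  then have cont: "continuous_on {a..b} w" "continuous_on {a..b} (bour_data.disc g A w \<mu>)"
    unfolding disc
    using bour_data.smooth_w[OF bd(1)] bour_data.smooth_g[OF bd(1)] bour_data.smooth_A[OF bd(1)]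
    by (auto intro!: continuous_intros)
  obtain x where x: "x \<in> {a..b}" "\<And>u. u \<in> {a..b} \<Longrightarrow> bour_data.disc g A w \<mu> x \<le> bour_data.disc g A w \<mu> u"
    using continuous_attains_inf[OF compact_Icc _ cont(2)] ab(1) by auto
  obtain y where y: "y \<in> {a..b}" "\<And>u. u \<in> {a..b} \<Longrightarrow> w u \<le> w y"
    using continuous_attains_sup[OF compact_Icc _ cont(1)] ab(1) by auto
  define \<delta> where "\<delta> = bour_data.disc g A w \<mu> x / w y"
  have "x \<in> I" "y \<in> I" using x(1) y(1) ab(2) by auto
  then have wy: "w y > 0" and \<delta>: "\<delta> > 0"
    using bd(3) bour_data.w_pos[OF bd(1)] by (simp_all add: \<delta>_def)
  \<comment> \<open>Squaring \<open>\<bar>\<mu>\<bar> + \<epsilon>\<close> adds \<epsilon> times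
    \<open>2 * \<bar>\<mu>\<bar> + \<epsilon>\<close> to \<mu>^2. The bound by 1 replaces the inner
    \<epsilon> by 1, so the added amount is at most \<delta>.\<close>
  define \<epsilon> where "\<epsilon> = min 1 (\<delta> / (2 * \<bar>\<mu>\<bar> + 1))"
  have "\<epsilon> \<le> \<delta> / (2 * \<bar>\<mu>\<bar> + 1)" by (simp add: \<epsilon>_def)
  then have \<epsilon>: "\<epsilon> > 0" "\<epsilon> \<le> 1" "\<epsilon> * (2 * \<bar>\<mu>\<bar> + 1) \<le> \<delta>"
    using \<delta> pos_le_divide_eq[of "2 * \<bar>\<mu>\<bar> + 1" \<epsilon> \<delta>] by (auto simp: \<epsilon>_def)
  have "\<exists>Rf Lf. isometric_translator_family \<mu> {a<..<b} R L {-(\<bar>\<mu>\<bar> + \<epsilon>)<..<\<bar>\<mu>\<bar> + \<epsilon>} Rf Lf"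
  proof (rule bour_data.isometric_family[OF bd'(1,2)])
    fix h u assume h: "h \<in> {-(\<bar>\<mu>\<bar> + \<epsilon>)<..<\<bar>\<mu>\<bar> + \<epsilon>}" and u: "u \<in> {a<..<b}"
    have "\<bar>h\<bar> < \<bar>\<mu>\<bar> + \<epsilon>" using h by auto
    then have "h\<^sup>2 < (\<bar>\<mu>\<bar> + \<epsilon>)\<^sup>2"
      by (metis abs_ge_zero power2_abs power_strict_mono zero_less_numeral)
    also have "(\<bar>\<mu>\<bar> + \<epsilon>)\<^sup>2 = \<mu>\<^sup>2 + \<epsilon> * (2 * \<bar>\<mu>\<bar> + \<epsilon>)"
      by (simp add: power2_eq_square algebra_simps)
    also have "\<dots> \<le> \<mu>\<^sup>2 + \<delta>"
      using \<epsilon> mult_left_le[of \<epsilon> \<epsilon>] unfolding distrib_left by linarith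
    finally have hd: "h\<^sup>2 < \<mu>\<^sup>2 + \<delta>" .
    have wu: "w u > 0" "w u \<le> w y" and dx: "w y * \<delta> \<le> bour_data.disc g A w \<mu> u"
      using u ab(2) x(2)[of u] y(2)[of u] wy bour_data.w_pos[OF bd'(1) u] by (auto simp: \<delta>_def)
    have "w u * (h\<^sup>2 - \<mu>\<^sup>2) < w u * \<delta>"
      using hd wu(1) by (intro mult_strict_left_mono) auto
    also have "\<dots> \<le> w y * \<delta>"
      using wu(2) \<delta> by (intro mult_right_mono) auto
    finally show "0 < bour_data.disc g A w h u"
      using dx unfolding disc by (simp add: algebra_simps)
  qed (use \<epsilon> in auto)
  then show ?thesis using \<epsilon>(1) by blast
qed

section \<open>Embedded translators\<close>

lemma K14_translator_translate:
  assumes "K14_translator \<Sigma>"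
  shows "K14_translator ((+) v ` \<Sigma>)"
  unfolding K14_translator_def
proof (intro conjI ballI)
  show "(+) v ` \<Sigma> \<noteq> {}" using assms by (auto simp: K14_translator_def)
  fix q assume "q \<in> (+) v ` \<Sigma>"
  then obtain p where p: "p \<in> \<Sigma>" "q = v + p" by auto
  then obtain D X V g where X: "p \<in> X ` D" "K14_patch D X" "open V" "homeomorphism D (\<Sigma> \<inter> V) X g"
    using assms unfolding K14_translator_def local_parametrization_def by blast
  have K: "K14_patch D (\<lambda>q. v + X q)" using K14_patch_add_const X(2) .
  have "homeomorphism (\<Sigma> \<inter> V) ((+) v ` (\<Sigma> \<inter> V)) ((+) v) ((+) (- v))"
    using homeomorphism_symD[OF homeomorphism_translation] .
  from homeomorphism_compose[OF X(4) this]
  have "homeomorphism D ((+) v ` (\<Sigma> \<inter> V)) (\<lambda>q. v + X q) (g \<circ> (+) (- v))"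
    by (simp add: o_def)
  then have "homeomorphism D ((+) v ` \<Sigma> \<inter> (+) v ` V) (\<lambda>q. v + X q) (g \<circ> (+) (- v))"
    by (simp add: image_Int)
  moreover have "open ((+) v ` V)" using X(3) by (rule open_translation)
  ultimately show "\<exists>D X. local_parametrization ((+) v ` \<Sigma>) D X \<and> q \<in> X ` D \<and> K14_patch D X"
    using K X(1) p(2) unfolding local_parametrization_def K14_patch_def by blast
qed

lemma K14_translatorI:
  assumes "\<Sigma> \<noteq> {}"
    and "\<And>p. p \<in> \<Sigma> \<Longrightarrow> \<exists>D X V g. K14_patch D X \<and> open V \<and> p \<in> V \<and> homeomorphism D (\<Sigma> \<inter> V) X g"
  shows "K14_translator \<Sigma>"
  unfolding K14_translator_def
proof (intro conjI ballI assms(1))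
  fix p assume p: "p \<in> \<Sigma>"
  from assms(2)[OF p] obtain D X V g
    where X: "K14_patch D X" "open V" "p \<in> V" "homeomorphism D (\<Sigma> \<inter> V) X g" by blast
  then have "p \<in> X ` D" using p by (auto simp: homeomorphism_def)
  then show "\<exists>D X. local_parametrization \<Sigma> D X \<and> p \<in> X ` D \<and> K14_patch D X"
    using X unfolding local_parametrization_def K14_patch_def by blast
qed

text \<open>The function \<rho> reads u off from the point, continuously on all of space, which
  excludes crossings of different orbits. For nonzero h the height then determines \<theta>, so one
  global chart suffices; for h = 0 the angle is determined only modulo 2 pi and charts are
  local.\<close>

lemma helicoidal_surface_embedded:
  assumes T: "helicoidal_translator h I R L" and R: "\<And>u. u \<in> I \<Longrightarrow> R u > 0"
    and \<rho>: "continuous_on UNIV \<rho>" "\<And>u \<theta>. u \<in> I \<Longrightarrow> \<rho> (helicoidal_map h R L (u, \<theta>)) = u"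
  shows "K14_translator (helicoidal_surface h I R L)"
proof (rule K14_translatorI)
  let ?X = "helicoidal_map h R L" and ?S = "helicoidal_surface h I R L"
  have I: "open I" "I \<noteq> {}" and sm: "smooth_on I R" "smooth_on I L" and K: "K14_patch (I \<times> UNIV) ?X"
    using T by (auto simp: helicoidal_translator_def)
  show "?S \<noteq> {}" using I by (auto simp: helicoidal_surface_def)
  have contX: "continuous_on (I \<times> UNIV) ?X"
    by (intro smooth_on_imp_continuous_on smooth_on_helicoidal_map I sm)
  have cont\<rho>: "continuous_on ?S \<rho>" using \<rho>(1) continuous_on_subset by blast
  have \<rho>I: "\<rho> p \<in> I" if "p \<in> ?S" for p using that \<rho>(2) by (auto simp: helicoidal_surface_def)
  have contL: "continuous_on ?S (\<lambda>p. L (\<rho> p))"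
    by (rule continuous_on_compose2[OF smooth_on_imp_continuous_on[OF sm(2)] cont\<rho>]) (use \<rho>I in auto)
  fix p assume "p \<in> ?S"
  then obtain u0 \<theta>0 where p: "p = ?X (u0, \<theta>0)" and u0: "u0 \<in> I" by (auto simp: helicoidal_surface_def)
  show "\<exists>D X V g. K14_patch D X \<and> open V \<and> p \<in> V \<and> homeomorphism D (?S \<inter> V) X g"
  proof (cases "h = 0")
    case False
    have "homeomorphism (I \<times> UNIV) ?S ?X (\<lambda>p. (\<rho> p, (p $ 3 - L (\<rho> p)) / h))"
    proof (rule homeomorphismI)
      show "continuous_on ?S (\<lambda>p. (\<rho> p, (p $ 3 - L (\<rho> p)) / h))"
        using False by (intro continuous_intros cont\<rho> contL) auto
      have X3: "(?X (u, \<theta>) $ 3 - L u) / h = \<theta>" for u \<theta>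
        using False by (simp add: helicoidal_map_def)
      have inv: "(\<rho> (?X q), (?X q $ 3 - L (\<rho> (?X q))) / h) = q" if "q \<in> I \<times> UNIV" for q
        using that X3 \<rho>(2) by (cases q) auto
      then show "(\<rho> (?X q), (?X q $ 3 - L (\<rho> (?X q))) / h) = q" if "q \<in> I \<times> UNIV" for q
        using that .
      show "?X (\<rho> p, (p $ 3 - L (\<rho> p)) / h) = p" if p: "p \<in> ?S" for p
      proof -
        obtain q where "q \<in> I \<times> UNIV" "p = ?X q" using p unfolding helicoidal_surface_def by blast
        then show ?thesis using inv[of q] by simp
      qed
    qed (use \<rho>I contX in \<open>auto simp: helicoidal_surface_def\<close>)
    then show ?thesis using K by (intro exI[of _ "I \<times> UNIV"] exI[of _ ?X] exI[of _ UNIV]) auto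
  next
    case True
    \<comment> \<open>Horizontal coordinates rotated by \<theta>0. The half-space a > 0 contains
      exactly those surface points whose angle is within pi/2 of \<theta>0 modulo 2 pi, and there b
      / a is the tangent of the angular difference.\<close>
    define a b :: "real^3 \<Rightarrow> real" where "a p = p $ 1 * cos \<theta>0 + p $ 2 * sin \<theta>0"
      and "b p = p $ 2 * cos \<theta>0 - p $ 1 * sin \<theta>0" for p
    define V where "V = {p. a p > 0}"
    define D where "D = I \<times> {\<theta>0 - pi/2<..<\<theta>0 + pi/2}"
    define G where "G p = (\<rho> p, \<theta>0 + arctan (b p / a p))" for p
    have ab: "a (?X (u, \<theta>)) = R u * cos (\<theta> - \<theta>0)" "b (?X (u, \<theta>)) = R u * sin (\<theta> - \<theta>0)" for u \<theta>
      by (simp_all add: a_def b_def helicoidal_map_def cos_diff sin_diff algebra_simps)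
    have V: "open V" unfolding V_def a_def by (intro open_Collect_less continuous_intros)
    have G: "G (?X (u, \<theta>)) = (u, \<theta>0 + arctan (tan (\<theta> - \<theta>0)))" if "u \<in> I" for u \<theta>
      using \<rho>(2)[OF that] R[OF that] by (simp add: G_def ab tan_def)
    \<comment> \<open>A point of V may be given by an angle on another sheet. Taking arctan of tan
      replaces the angular difference by its representative in the open interval from -pi/2 to pi/2;
      the cosine being positive, this changes neither sine nor cosine.\<close>
    have XG: "?X (u, \<theta>0 + arctan (tan (\<theta> - \<theta>0))) = ?X (u, \<theta>)" if "cos (\<theta> - \<theta>0) > 0" for u \<theta>
    proof -
      define \<delta> where "\<delta> = \<theta> - \<theta>0"
      have "sqrt (1 + (tan \<delta>)\<^sup>2) = inverse (cos \<delta>)"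
        using that tan_sec[of \<delta>] by (simp add: \<delta>_def)
      then have *: "cos (arctan (tan \<delta>)) = cos \<delta>" "sin (arctan (tan \<delta>)) = sin \<delta>"
        using that by (simp_all add: cos_arctan sin_arctan \<delta>_def tan_def divide_inverse)
      have "cos (\<theta>0 + arctan (tan \<delta>)) = cos (\<theta>0 + \<delta>)" "sin (\<theta>0 + arctan (tan \<delta>)) = sin (\<theta>0 + \<delta>)"
        by (simp_all only: cos_add sin_add *)
      then show ?thesis using True by (simp add: helicoidal_map_def \<delta>_def)
    qed
    have cpos: "cos (\<theta> - \<theta>0) > 0" if "\<theta> \<in> {\<theta>0 - pi/2<..<\<theta>0 + pi/2}" for \<theta>
      using that by (intro cos_gt_zero_pi) auto
    have "homeomorphism D (?S \<inter> V) ?X G"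
    proof (rule homeomorphismI)
      show "continuous_on D ?X" using contX by (rule continuous_on_subset) (auto simp: D_def)
      show "continuous_on (?S \<inter> V) G"
        unfolding G_def a_def b_def
        by (intro continuous_intros continuous_on_subset[OF cont\<rho>]) (auto simp: V_def a_def)
      show "?X ` D \<subseteq> ?S \<inter> V"
        using cpos R by (auto simp: D_def V_def ab helicoidal_surface_def)
      show "G ` (?S \<inter> V) \<subseteq> D"
        using \<rho>I arctan_lbound arctan_ubound by (auto simp: D_def G_def)
      show "G (?X q) = q" if qD: "q \<in> D" for q
      proof -
        obtain u \<theta> where q: "q = (u, \<theta>)" "u \<in> I" "\<theta> \<in> {\<theta>0 - pi/2<..<\<theta>0 + pi/2}"
          using qD by (auto simp: D_def)
        have "arctan (tan (\<theta> - \<theta>0)) = \<theta> - \<theta>0" using q(3) by (intro arctan_tan) auto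
        then show ?thesis using G[OF q(2), of \<theta>] q(1) by simp
      qed
      show "?X (G q) = q" if q: "q \<in> ?S \<inter> V" for q
      proof -
        obtain u \<theta> where "q = ?X (u, \<theta>)" "u \<in> I" using q by (auto simp: helicoidal_surface_def)
        moreover from this have "cos (\<theta> - \<theta>0) > 0"
          using q R by (auto simp: V_def ab zero_less_mult_iff dest: less_asym)
        ultimately show ?thesis using G XG by simp
      qed
    qed
    moreover have "K14_patch D ?X"
      using K by (rule K14_patch_subset) (auto simp: D_def I intro: open_Times)
    moreover have "p \<in> V" using R[OF u0] by (simp add: p V_def ab)
    ultimately show ?thesis using V by blast
  qed
qed

section \<open>Cylinders, the paraboloid and screw invariance\<close>

lemma circle_polar:
  fixes x y r :: real
  assumes "x\<^sup>2 + y\<^sup>2 = r\<^sup>2"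
  obtains \<theta> where "x = r * cos \<theta>" "y = r * sin \<theta>"
proof (cases "r = 0")
  case True
  then show ?thesis using assms that[of 0] by (simp add: sum_power2_eq_zero_iff)
next
  case False
  then have "(x / r)\<^sup>2 + (y / r)\<^sup>2 = 1"
    using assms by (simp add: power_divide add_divide_distrib[symmetric])
  then obtain t where "x / r = cos t" "y / r = sin t" using sincos_total_2pi by metis
  then show ?thesis using that[of t] False by (simp add: field_simps)
qed

lemma cylinder_eq_surface: "cylinder 0 0 r = helicoidal_surface 0 UNIV (\<lambda>_. r) (\<lambda>u. u)"
proof (intro equalityI subsetI)
  fix p assume "p \<in> cylinder 0 0 r"
  then have "(p $ 1)\<^sup>2 + (p $ 2)\<^sup>2 = r\<^sup>2" by (simp add: cylinder_def)
  then obtain \<theta> where "p $ 1 = r * cos \<theta>" "p $ 2 = r * sin \<theta>" by (rule circle_polar)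
  then have "p = helicoidal_map 0 (\<lambda>_. r) (\<lambda>u. u) (p $ 3, \<theta>)"
    by (simp add: helicoidal_map_def vec_eq_iff forall_3)
  then show "p \<in> helicoidal_surface 0 UNIV (\<lambda>_. r) (\<lambda>u. u)"
    by (auto simp: helicoidal_surface_def)
next
  fix p assume "p \<in> helicoidal_surface 0 UNIV (\<lambda>_. r) (\<lambda>u. u)"
  then show "p \<in> cylinder 0 0 r"
    by (auto simp: helicoidal_surface_def helicoidal_map_def cylinder_def power_mult_distrib
        distrib_left[symmetric])
qed

lemma cylinder_translator:
  assumes "r > 0"
  shows "rotational_surface (cylinder 0 0 r)" "K14_translator (cylinder x y r)"
proof -
  show "rotational_surface (cylinder 0 0 r)"
    unfolding rotational_surface_def cylinder_eq_surface
    by (intro exI[of _ UNIV] exI[of _ "\<lambda>_. r"] exI[of _ "\<lambda>u. u"]) auto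
  have "K14_patch (UNIV \<times> UNIV) (helicoidal_map 0 (\<lambda>_. r) (\<lambda>u. u))"
    \<comment> \<open>A constant radius makes A vanish and w constant: the normal is horizontal and
      the curvature is zero, so both sides of the equation are 0.\<close>
    by (subst K14_helicoidal_iff[where A = "\<lambda>_. 0" and w = "\<lambda>_. r\<^sup>2" and A' = "\<lambda>_. 0" and w' = "\<lambda>_. 0"])
      (use assms in \<open>auto intro: smooth_intros\<close>)
  then have "helicoidal_translator 0 UNIV (\<lambda>_. r) (\<lambda>u. u)"
    by (auto simp: helicoidal_translator_def intro: smooth_intros)
  then have "K14_translator (cylinder 0 0 r)"
    unfolding cylinder_eq_surface
    by (rule helicoidal_surface_embedded[where \<rho> = "\<lambda>p. p $ 3"])
      (use assms in \<open>auto simp: helicoidal_map_def intro!: continuous_intros\<close>)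
  moreover have "(+) (vector [x, y, 0]) ` cylinder 0 0 r = cylinder x y r"
  proof (intro equalityI subsetI)
    fix p assume "p \<in> cylinder x y r"
    then have "p - vector [x, y, 0] \<in> cylinder 0 0 r" by (simp add: cylinder_def)
    then show "p \<in> (+) (vector [x, y, 0]) ` cylinder 0 0 r"
      by (metis add_diff_cancel_left' diff_add_cancel add.commute image_eqI)
  qed (auto simp: cylinder_def)
  ultimately show "K14_translator (cylinder x y r)"
    using K14_translator_translate by metis
qed

text \<open>Polar coordinates break down at the vertex, so the chart is the graph over the plane.
  With n = (-x, -y, 1) the second derivatives paired with n give 1, 0, 1, and the condition reads 1
  = 1.\<close>

lemma paraboloid_translator: "K14_translator {p. p $ 3 = ((p $ 1)\<^sup>2 + (p $ 2)\<^sup>2) / 2 + k}"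
proof (rule K14_translatorI)
  let ?S = "{p :: real^3. p $ 3 = ((p $ 1)\<^sup>2 + (p $ 2)\<^sup>2) / 2 + k}"
  define X :: "real \<times> real \<Rightarrow> real^3"
    where "X = (\<lambda>p. vector [fst p, snd p, ((fst p)\<^sup>2 + (snd p)\<^sup>2) / 2 + k])"
  have "(vector [0, 0, k] :: real^3) \<in> ?S" by simp
  then show "?S \<noteq> {}" by blast
  have smX: "smooth_on UNIV X"
    unfolding X_def by (intro smooth_on_vec3 smooth_intros smooth_on_fst_snd) auto
  have "(X has_derivative (\<lambda>v. vector [fst v, snd v, fst p * fst v + snd p * snd v])) (at p)" for p
    unfolding X_def by (intro has_derivative_vec3) (auto intro!: derivative_eq_intros)
  from d_eqI[OF this] have d: "d1 X = (\<lambda>p. vector [1, 0, fst p])" "d2 X = (\<lambda>p. vector [0, 1, snd p])"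
    by (simp_all add: fun_eq_iff)
  have "((\<lambda>p. vector [1, 0, fst p] :: real^3) has_derivative (\<lambda>v. vector [0, 0, fst v])) (at p)"
    "((\<lambda>p. vector [0, 1, snd p] :: real^3) has_derivative (\<lambda>v. vector [0, 0, snd v])) (at p)"
    for p :: "real \<times> real"
    by (intro has_derivative_vec3; auto intro!: derivative_eq_intros)+
  note dd = this[THEN d_eqI(1)] this[THEN d_eqI(2)]
  have n: "cross3 (d1 X p) (d2 X p) = vector [- fst p, - snd p, 1]" for p
    by (simp add: d cross_vec3)
  have ne: "cross3 (d1 X p) (d2 X p) \<noteq> 0" for p by (simp add: n vec3_eq_0)
  have "gauss_curvature X p = angle_function X p ^ 4" for p
    unfolding K14_condition_iff[OF ne] n by (simp add: inner_vec3 d dd)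
  with ne have K: "K14_patch UNIV X"
    using smX by (simp add: K14_patch_def regular_patch_def)
  have "homeomorphism UNIV ?S X (\<lambda>p. (p $ 1, p $ 2))"
    by (rule homeomorphismI)
      (use smooth_on_imp_continuous_on[OF smX] in \<open>auto intro!: continuous_intros simp: X_def vec_eq_iff forall_3\<close>)
  then show "\<exists>D X V g. K14_patch D X \<and> open V \<and> p \<in> V \<and> homeomorphism D (?S \<inter> V) X g" for p
    using K by (intro exI[of _ UNIV] exI[of _ X]) auto
qed

text \<open>In the parameters the motion is the translation of \<theta> by T, and \<theta> runs over
  the whole line.\<close>

lemma screw_motion_helicoidal_surface:
  "screw_motion h T ` helicoidal_surface h P R L = helicoidal_surface h P R L"
proof -
  have *: "screw_motion h T (helicoidal_map h R L (u, \<theta>)) = helicoidal_map h R L (u, \<theta> + T)" for u \<theta> T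
    by (simp add: screw_motion_def helicoidal_map_def Let_def cis_conv_exp[symmetric] cos_add sin_add
        algebra_simps vec_eq_iff forall_3)
  have "screw_motion h T ` helicoidal_surface h P R L = (\<lambda>(u, \<theta>). helicoidal_map h R L (u, \<theta> + T)) ` (P \<times> UNIV)"
    unfolding helicoidal_surface_def image_image by (intro image_cong) (auto simp: *)
  also have "\<dots> = helicoidal_map h R L ` (\<lambda>(u, \<theta>). (u, \<theta> + T)) ` (P \<times> UNIV)"
    by (simp add: image_image case_prod_beta')
  also have "(\<lambda>(u, \<theta>). (u, \<theta> + T)) ` (P \<times> UNIV) = P \<times> (UNIV :: real set)"
    by (force intro: image_eqI[where x = "(u, \<theta> - T)" for u \<theta>])
  finally show ?thesis by (simp add: helicoidal_surface_def)
qed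

section \<open>The two-parameter family\<close>

text \<open>In terms of \<open>S = U\<^sup>2\<close> the radicand of \<open>L'\<close> is \<open>S (S\<^sup>2 + (c - 1 - h\<^sup>2) S - h\<^sup>2 c)\<close>; \<open>lower_sq\<close> is the
  larger root of the quadratic factor.\<close>

definition lower_sq :: "real \<Rightarrow> real \<Rightarrow> real" where
  "lower_sq h c = ((1 + h\<^sup>2 - c) + sqrt ((c - 1 - h\<^sup>2)\<^sup>2 + 4 * h\<^sup>2 * c)) / 2"

definition lower :: "real \<Rightarrow> real \<Rightarrow> real" where
  "lower h c = sqrt (lower_sq h c)"

definition family_slope :: "real \<Rightarrow> real \<Rightarrow> real \<Rightarrow> real" where
  "family_slope h c U = sqrt (U\<^sup>2 * (U\<^sup>2 + c) * (U\<^sup>2 - h\<^sup>2) - U\<^sup>2 * U\<^sup>2) / (U\<^sup>2 - h\<^sup>2)"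

definition family_R :: "real \<Rightarrow> real \<Rightarrow> real \<Rightarrow> real" where
  "family_R h c U = sqrt (U\<^sup>2 - h\<^sup>2)"

text \<open>The base point must lie in the range and vary continuously with h and c, for the sake of
  joint continuity. This choice normalizes the heights, which is why the explicit formulas appear
  only up to a vertical translation.\<close>

definition family_L :: "real \<Rightarrow> real \<Rightarrow> real \<Rightarrow> real" where
  "family_L h c U = antideriv_from (lower h c + 1) (family_slope h c) U"

text \<open>The discriminant equals (h^2 - 1 + c)^2 + 4 h^2, so its root is at least the absolute
  value of h^2 - 1 + c. The larger root of the quadratic is therefore at least the maximum of h^2
  and 1 - c.\<close>

lemma lower_sq_ge: "h\<^sup>2 \<le> lower_sq h c" "1 - c \<le> lower_sq h c"
proof -
  have eq: "(c - 1 - h\<^sup>2)\<^sup>2 + 4 * h\<^sup>2 * c = (h\<^sup>2 - 1 + c)\<^sup>2 + 4 * h\<^sup>2" by algebra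
  have "\<bar>h\<^sup>2 - 1 + c\<bar> \<le> sqrt ((c - 1 - h\<^sup>2)\<^sup>2 + 4 * h\<^sup>2 * c)"
    unfolding eq by (intro real_le_rsqrt) (simp add: power2_abs)
  then show "h\<^sup>2 \<le> lower_sq h c" "1 - c \<le> lower_sq h c"
    by (simp_all add: lower_sq_def)
qed

lemma lower_0: "lower 0 c = (if c \<ge> 1 then 0 else sqrt (1 - c))"
  by (simp add: lower_def lower_sq_def)

lemma lower_nonneg: "lower h c \<ge> 0"
  unfolding lower_def using lower_sq_ge(1)[of h c] zero_le_power2[of h] by (intro real_sqrt_ge_zero) linarith

lemma lower_ge_lower_0: "lower 0 c \<le> lower h c"
  using lower_nonneg lower_sq_ge(2)[of c h] by (auto simp: lower_0) (simp add: lower_def)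

text \<open>Beyond the larger root the quadratic factor is positive. This is seen by completing the
  square: four times the factor is (2 U^2 - (1 + h^2 - c))^2 minus the discriminant.\<close>

lemma lower_lessD:
  assumes "lower h c < U"
  shows "U > 0" "U\<^sup>2 > h\<^sup>2" "U\<^sup>2 + c > 1" "(U\<^sup>2 + c) * (U\<^sup>2 - h\<^sup>2) > U\<^sup>2"
proof -
  show U: "U > 0" using assms lower_nonneg[of h c] by linarith
  have S: "U\<^sup>2 > lower_sq h c"
    using assms U real_sqrt_less_iff[of "lower_sq h c" "U\<^sup>2"] by (simp add: lower_def)
  then show "U\<^sup>2 > h\<^sup>2" "U\<^sup>2 + c > 1" using lower_sq_ge[of h c] lower_sq_ge(2)[of c h] by linarith+
  define D where "D = (c - 1 - h\<^sup>2)\<^sup>2 + 4 * h\<^sup>2 * c"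
  have "D = (h\<^sup>2 - 1 + c)\<^sup>2 + 4 * h\<^sup>2" unfolding D_def by algebra
  then have "D \<ge> 0" by simp
  have "2 * U\<^sup>2 - (1 + h\<^sup>2 - c) > sqrt D" using S by (simp add: lower_sq_def D_def)
  then have "(2 * U\<^sup>2 - (1 + h\<^sup>2 - c))\<^sup>2 > D"
    using \<open>D \<ge> 0\<close> by (metis power_strict_mono real_sqrt_ge_zero real_sqrt_pow2 zero_less_numeral)
  moreover have "(2 * U\<^sup>2 - (1 + h\<^sup>2 - c))\<^sup>2 - D = 4 * ((U\<^sup>2 + c) * (U\<^sup>2 - h\<^sup>2) - U\<^sup>2)"
    unfolding D_def by algebra
  ultimately show "(U\<^sup>2 + c) * (U\<^sup>2 - h\<^sup>2) > U\<^sup>2" by simp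
qed

text \<open>With G = U^2 and A = U the curvature equation becomes the linear equation U w' / 2 - w =
  U^4. Its solutions for U > 0 are U^4 + c U^2, so c is the constant of integration.\<close>

lemma family_bour_data:
  "bour_data {lower h c<..} (\<lambda>U. U\<^sup>2) (\<lambda>U. U) (\<lambda>U. U\<^sup>2 * (U\<^sup>2 + c))"
proof
  show "smooth_on {lower h c<..} (\<lambda>U. U\<^sup>2)" "smooth_on {lower h c<..} (\<lambda>U. U\<^sup>2 * (U\<^sup>2 + c))"
    by (intro smooth_intros; simp)+
  fix U assume "U \<in> {lower h c<..}"
  note U = lower_lessD[of h c U]
  show "U\<^sup>2 > 0" "U\<^sup>2 * (U\<^sup>2 + c) > 0" using U \<open>U \<in> _\<close> by auto
  show "((\<lambda>U. U\<^sup>2) has_real_derivative 2 * U) (at U)"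
    by (auto intro!: derivative_eq_intros)
  have "((\<lambda>U. U\<^sup>2 * (U\<^sup>2 + c)) has_real_derivative 4 * U ^ 3 + 2 * c * U) (at U)"
    by (auto intro!: derivative_eq_intros simp: algebra_simps power2_eq_square power3_eq_cube)
  from DERIV_imp_deriv[OF this]
  show "U * deriv (\<lambda>U. U\<^sup>2 * (U\<^sup>2 + c)) U / 2 - deriv (\<lambda>U. U) U * (U\<^sup>2 * (U\<^sup>2 + c)) = U ^ 4"
    by (simp add: field_simps power2_eq_square power3_eq_cube power4_eq_xxxx)
qed (auto simp: is_interval_1 gt_ex)

lemma family_disc_pos:
  assumes "lower h c < U"
  shows "bour_data.disc (\<lambda>U. U\<^sup>2) (\<lambda>U. U) (\<lambda>U. U\<^sup>2 * (U\<^sup>2 + c)) h U > 0"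
proof -
  have "U\<^sup>2 * ((U\<^sup>2 + c) * (U\<^sup>2 - h\<^sup>2) - U\<^sup>2) > 0"
    using lower_lessD[OF assms] by (intro mult_pos_pos) auto
  then show ?thesis
    unfolding bour_data.disc_def[OF family_bour_data] by (simp add: algebra_simps)
qed

lemma family_slope_eq:
  "bour_data.slope (\<lambda>U. U\<^sup>2) (\<lambda>U. U) (\<lambda>U. U\<^sup>2 * (U\<^sup>2 + c)) h = family_slope h c"
  by (simp add: fun_eq_iff bour_data.slope_def[OF family_bour_data] bour_data.disc_def[OF family_bour_data]
      family_slope_def)

lemma family_L_derivative:
  assumes "lower h c < U"
  shows "(family_L h c has_real_derivative family_slope h c U) (at U)"
  unfolding family_L_def[abs_def]
proof (rule antideriv_from_has_derivative)
  show "continuous_on {lower h c<..} (family_slope h c)"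
    using bour_data.smooth_on_slope[OF family_bour_data family_disc_pos]
    by (auto simp: family_slope_eq intro: smooth_on_imp_continuous_on)
qed (use assms in \<open>auto simp: is_interval_1\<close>)

lemma family_realizes:
  "bour_data.realizes {lower h c<..} (\<lambda>U. U\<^sup>2) (\<lambda>U. U) (\<lambda>U. U\<^sup>2 * (U\<^sup>2 + c)) h (family_R h c) (family_L h c)"
proof -
  have "bour_data.realizes {lower h c<..} (\<lambda>U. U\<^sup>2) (\<lambda>U. U) (\<lambda>U. U\<^sup>2 * (U\<^sup>2 + c)) h
      (\<lambda>U. 1 * sqrt (U\<^sup>2 - h\<^sup>2)) (family_L h c)"
    by (rule bour_data.realizes_bour[OF family_bour_data, where \<tau> = 1])
      (auto simp: family_slope_eq intro: family_disc_pos family_L_derivative)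
  then show ?thesis by (simp add: family_R_def[abs_def])
qed

lemma family_translator: "helicoidal_translator h {lower h c<..} (family_R h c) (family_L h c)"
  using bour_data.realizes_translator[OF family_bour_data family_realizes] .

lemma realizes_subset:
  assumes "bour_data I g A w" "bour_data J g A w" "J \<subseteq> I" "bour_data.realizes I g A w h R L"
  shows "bour_data.realizes J g A w h R L"
  using assms(3,4) smooth_on_subset[OF _ assms(3)]
  unfolding bour_data.realizes_def[OF assms(1)] bour_data.realizes_def[OF assms(2)] by auto

text \<open>The range at pitch h starts no earlier than the one at pitch 0. The comparison is
  therefore with the part of the rotational surface over the same U, and there both patches realize
  the same data.\<close>

lemma family_isometric:
  "isometric_patches ({lower h c<..} \<times> UNIV) (helicoidal_map h (family_R h c) (family_L h c))
     ({lower h c<..} \<times> UNIV) (helicoidal_map 0 (family_R 0 c) (family_L 0 c))"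
proof (rule bour_data.realizes_isometric[OF family_bour_data family_realizes])
  have sub: "{lower h c<..} \<subseteq> {lower 0 c<..}" using lower_ge_lower_0[of c h] by auto
  show "bour_data.realizes {lower h c<..} (\<lambda>U. U\<^sup>2) (\<lambda>U. U) (\<lambda>U. U\<^sup>2 * (U\<^sup>2 + c)) 0
      (family_R 0 c) (family_L 0 c)"
    by (rule realizes_subset[OF family_bour_data family_bour_data sub family_realizes])
qed

text \<open>The shear with \<psi>' = -h L' / U^2 makes F vanish, so the curves of constant t meet
  the screw orbits at right angles. Then E = w / g, and A / sqrt w simplifies without a sign because
  U > 0.\<close>

lemma family_coordinates:
  "\<exists>\<phi>. diffeo ({lower h c<..} \<times> UNIV) ({lower h c<..} \<times> UNIV) \<phi> \<and> (\<forall>p. fst (\<phi> p) = fst p) \<and>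
     (let X = helicoidal_map h (family_R h c) (family_L h c) \<circ> \<phi> in
        \<forall>U t. U > lower h c \<longrightarrow>
          ff_E X (U, t) = U\<^sup>2 + c \<and> ff_F X (U, t) = 0 \<and> ff_G X (U, t) = U\<^sup>2 \<and>
          angle_function X (U, t) = 1 / sqrt (U\<^sup>2 + c))"
proof -
  note bd = family_bour_data[of h c]
  have "smooth_on {lower h c<..} (\<lambda>U. - (h * deriv (family_L h c) U / U\<^sup>2))"
    by (intro smooth_on_uminus bour_data.smooth_on_screw_rate[OF bd family_realizes]) auto
  from bour_data.antiderivative_ex[OF bd this] obtain \<psi> where \<psi>: "smooth_on {lower h c<..} \<psi>"
    "\<And>U. U \<in> {lower h c<..} \<Longrightarrow> (\<psi> has_real_derivative - (h * deriv (family_L h c) U / U\<^sup>2)) (at U)"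
    by blast
  let ?X = "helicoidal_map h (family_R h c) (family_L h c) \<circ> shear \<psi>"
  have "ff_E ?X (U, t) = U\<^sup>2 + c \<and> ff_F ?X (U, t) = 0 \<and> ff_G ?X (U, t) = U\<^sup>2 \<and>
      angle_function ?X (U, t) = 1 / sqrt (U\<^sup>2 + c)" if U: "U > lower h c" for U t
  proof -
    have "U > 0" using lower_lessD(1)[OF U] .
    moreover have "U \<in> {lower h c<..}" using U by simp
    ultimately show ?thesis
      using bour_data.realizes_shear[OF bd family_realizes \<open>U \<in> _\<close> \<psi>(2)[OF \<open>U \<in> _\<close>], of t]
      by (simp add: real_sqrt_mult)
  qed
  moreover have "fst (shear \<psi> p) = fst p" for p by (simp add: shear_def case_prod_beta')
  ultimately show ?thesis
    using diffeo_shear[OF _ \<psi>(1)] by (intro exI[of _ "shear \<psi>"]) (auto simp: Let_def)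
qed

lemma continuous_on_lower: "continuous_on UNIV (\<lambda>(h, c). lower h c)"
  unfolding lower_def lower_sq_def case_prod_beta' by (intro continuous_intros) auto

lemma continuous_on_family:
  "continuous_on {(h, c, U). lower h c < U} (\<lambda>(h, c, U). (family_R h c U, family_L h c U))"
proof -
  let ?S = "{(h, c, U). lower h c < U}"
  have lower: "continuous_on S (\<lambda>s. lower (fst s) (fst (snd s)))" for S :: "(real \<times> real \<times> real) set"
    unfolding lower_def lower_sq_def by (intro continuous_intros) auto
  have "continuous_on {(s, x). s \<in> ?S \<and> lower (fst s) (fst (snd s)) < x} (\<lambda>(s, x). family_slope (fst s) (fst (snd s)) x)"
    unfolding family_slope_def case_prod_beta'
    by (intro continuous_intros) (use lower_lessD(2) in force)
  then have "continuous_on ?S (\<lambda>s. antideriv_from (lower (fst s) (fst (snd s)) + 1) (family_slope (fst s) (fst (snd s))) (snd (snd s)))"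
  proof (rule continuous_on_antideriv_from[rotated 2])
    fix s t assume s: "s \<in> ?S" and t: "t \<in> {0..1::real}"
    have "lower (fst s) (fst (snd s)) + 1 + (snd (snd s) - (lower (fst s) (fst (snd s)) + 1)) * t
        \<in> {lower (fst s) (fst (snd s))<..}"
      by (rule segment_in_interval[OF _ _ _ t]) (use s in \<open>auto simp: is_interval_1\<close>)
    then show "(s, lower (fst s) (fst (snd s)) + 1 + (snd (snd s) - (lower (fst s) (fst (snd s)) + 1)) * t)
        \<in> {(s, x). s \<in> ?S \<and> lower (fst s) (fst (snd s)) < x}"
      using s by simp
  qed (intro continuous_intros lower)+
  then show ?thesis
    unfolding family_R_def family_L_def case_prod_beta' by (intro continuous_intros)
qed

section \<open>The rotational members and the explicit height functions\<close>

lemma family_slope_0: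
  shows "family_slope 0 c U = (if U = 0 then 0 else sqrt (U\<^sup>2 + c - 1))"
proof -
  have "U\<^sup>2 * (U\<^sup>2 + c) * (U\<^sup>2 - 0\<^sup>2) - U\<^sup>2 * U\<^sup>2 = (U\<^sup>2)\<^sup>2 * (U\<^sup>2 + c - 1)"
    by (simp add: power2_eq_square algebra_simps)
  moreover have "sqrt ((U\<^sup>2)\<^sup>2 * (U\<^sup>2 + c - 1)) = U\<^sup>2 * sqrt (U\<^sup>2 + c - 1)"
    by (simp only: real_sqrt_mult real_sqrt_abs abs_power2)
  \<comment> \<open>At U = 0 the quotient is 0 / 0, which is 0 by convention. For c = 1 this is also
    the value of sqrt (U^2 + c - 1), so the slope formula extends to the vertex.\<close>
  ultimately show ?thesis
    unfolding family_slope_def by simp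
qed

text \<open>Let q be the square root in the formula. For c different from 1 the derivative is (q +
  q^2 / q) / 2 = q, since the terms in U^2 and \<kappa>^2 combine to q^2.\<close>

lemma height_derivative:
  assumes "lower 0 c < U"
  shows "(height c has_real_derivative sqrt (U\<^sup>2 + c - 1)) (at U)"
proof -
  have U: "U > 0" using lower_lessD(1)[OF assms] .
  consider "c > 1" | "c = 1" | "c < 1" by linarith
  then show ?thesis
  proof cases
    case 1
    define \<kappa> where "\<kappa> = sqrt (c - 1)"
    have \<kappa>: "\<kappa> > 0" "\<kappa>\<^sup>2 = c - 1" using 1 by (auto simp: \<kappa>_def)
    define q where "q = sqrt (U\<^sup>2 + \<kappa>\<^sup>2)"
    have q: "q > 0" "q\<^sup>2 = U\<^sup>2 + \<kappa>\<^sup>2" using \<kappa>(1) by (auto simp: q_def add_pos_nonneg add_nonneg_pos)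
    have "(U / \<kappa>)\<^sup>2 + 1 = (U\<^sup>2 + \<kappa>\<^sup>2) / \<kappa>\<^sup>2" using \<kappa>(1) by (simp add: field_simps power2_eq_square)
    then have ar: "sqrt ((U / \<kappa>)\<^sup>2 + 1) = q / \<kappa>" using \<kappa>(1) by (simp add: real_sqrt_divide q_def)
    have "((\<lambda>U. U\<^sup>2 + \<kappa>\<^sup>2) has_real_derivative 2 * U) (at U)"
      by (auto intro!: derivative_eq_intros)
    from DERIV_chain2[OF DERIV_real_sqrt this]
    have "((\<lambda>U. sqrt (U\<^sup>2 + \<kappa>\<^sup>2)) has_real_derivative inverse q / 2 * (2 * U)) (at U)"
      using q by (simp add: q_def)
    then have d1: "((\<lambda>U. sqrt (U\<^sup>2 + \<kappa>\<^sup>2)) has_real_derivative U / q) (at U)"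
      by (rule DERIV_cong) (use q(1) in \<open>simp add: field_simps\<close>)
    have "(arsinh has_real_derivative 1 / (q / \<kappa>)) (at (U / \<kappa>))"
      unfolding ar[symmetric] by (rule arsinh_real_has_field_derivative)
    then have d2: "((\<lambda>U. arsinh (U / \<kappa>)) has_real_derivative 1 / (q / \<kappa>) * (1 / \<kappa>)) (at U)"
      by (rule DERIV_chain2) (rule DERIV_cdivide[OF DERIV_ident])
    have "((\<lambda>U. (U * sqrt (U\<^sup>2 + \<kappa>\<^sup>2) + \<kappa>\<^sup>2 * arsinh (U / \<kappa>)) / 2) has_real_derivative
        (q + U * (U / q) + \<kappa>\<^sup>2 * (1 / (q / \<kappa>) * (1 / \<kappa>))) / 2) (at U)"
      by (rule DERIV_cong[OF DERIV_cdivide[OF DERIV_add[OF DERIV_mult[OF DERIV_ident d1] DERIV_cmult[OF d2]]]])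
        (simp add: q_def mult.commute)
    also have "(q + U * (U / q) + \<kappa>\<^sup>2 * (1 / (q / \<kappa>) * (1 / \<kappa>))) / 2 = q"
      using q \<kappa>(1) by (simp add: field_simps power2_eq_square)
    also have "q = sqrt (U\<^sup>2 + c - 1)" by (simp add: q_def \<kappa>(2))
    finally show ?thesis using 1 by (simp add: height_def[abs_def] \<kappa>_def)
  next
    case 2
    then show ?thesis using U by (auto simp: height_def[abs_def] intro!: derivative_eq_intros)
  next
    case 3
    define \<kappa> where "\<kappa> = sqrt (1 - c)"
    have \<kappa>: "\<kappa> > 0" "\<kappa>\<^sup>2 = 1 - c" using 3 by (auto simp: \<kappa>_def)
    have U\<kappa>: "U > \<kappa>" using assms 3 by (simp add: lower_0 \<kappa>_def)
    then have "U\<^sup>2 > \<kappa>\<^sup>2" using \<kappa>(1) by (intro power_strict_mono) auto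
    define q where "q = sqrt (U\<^sup>2 - \<kappa>\<^sup>2)"
    have q: "q > 0" "q\<^sup>2 = U\<^sup>2 - \<kappa>\<^sup>2" using \<open>U\<^sup>2 > \<kappa>\<^sup>2\<close> by (auto simp: q_def)
    have "(U / \<kappa>)\<^sup>2 - 1 = (U\<^sup>2 - \<kappa>\<^sup>2) / \<kappa>\<^sup>2" using \<kappa>(1) by (simp add: field_simps power2_eq_square)
    then have ar: "sqrt ((U / \<kappa>)\<^sup>2 - 1) = q / \<kappa>" using \<kappa>(1) by (simp add: real_sqrt_divide q_def)
    have "((\<lambda>U. U\<^sup>2 - \<kappa>\<^sup>2) has_real_derivative 2 * U) (at U)"
      by (auto intro!: derivative_eq_intros)
    from DERIV_chain2[OF DERIV_real_sqrt this]
    have "((\<lambda>U. sqrt (U\<^sup>2 - \<kappa>\<^sup>2)) has_real_derivative inverse q / 2 * (2 * U)) (at U)"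
      using q by (simp add: q_def)
    then have d1: "((\<lambda>U. sqrt (U\<^sup>2 - \<kappa>\<^sup>2)) has_real_derivative U / q) (at U)"
      by (rule DERIV_cong) (use q(1) in \<open>simp add: field_simps\<close>)
    have "(arcosh has_real_derivative 1 / (q / \<kappa>)) (at (U / \<kappa>))"
      unfolding ar[symmetric] by (rule arcosh_real_has_field_derivative) (use U\<kappa> \<kappa>(1) in simp)
    then have d2: "((\<lambda>U. arcosh (U / \<kappa>)) has_real_derivative 1 / (q / \<kappa>) * (1 / \<kappa>)) (at U)"
      by (rule DERIV_chain2) (rule DERIV_cdivide[OF DERIV_ident])
    have "((\<lambda>U. (U * sqrt (U\<^sup>2 - \<kappa>\<^sup>2) - \<kappa>\<^sup>2 * arcosh (U / \<kappa>)) / 2) has_real_derivative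
        (q + U * (U / q) - \<kappa>\<^sup>2 * (1 / (q / \<kappa>) * (1 / \<kappa>))) / 2) (at U)"
      by (rule DERIV_cong[OF DERIV_cdivide[OF DERIV_diff[OF DERIV_mult[OF DERIV_ident d1] DERIV_cmult[OF d2]]]])
        (simp add: q_def mult.commute)
    also have "(q + U * (U / q) - \<kappa>\<^sup>2 * (1 / (q / \<kappa>) * (1 / \<kappa>))) / 2 = (q + (U\<^sup>2 - \<kappa>\<^sup>2) / q) / 2"
      using \<kappa>(1) by (simp add: power2_eq_square diff_divide_distrib)
    also have "\<dots> = q"
      unfolding q(2)[symmetric] using q(1) by (simp add: power2_eq_square)
    also have "q = sqrt (U\<^sup>2 + c - 1)" by (simp add: q_def \<kappa>(2) algebra_simps)
    finally show ?thesis using 3 by (simp add: height_def[abs_def] \<kappa>_def)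
  qed
qed

text \<open>This covers the closed half-line, beyond the open range of the smooth patch, so the
  derivative at 0 is one-sided. The constant 1/2 comes from the base point
  \<open>lower 0 1 + 1\<close>, which is 1.\<close>

lemma family_L_paraboloid:
  assumes "U \<ge> 0"
  shows "family_L 0 1 U = U\<^sup>2 / 2 - 1 / 2"
proof -
  have "family_L 0 1 U = U\<^sup>2 / 2 - (lower 0 1 + 1)\<^sup>2 / 2"
    unfolding family_L_def
  proof (rule antideriv_from_eq[where I = "{0..}" and G = "\<lambda>x. x\<^sup>2 / 2"])
    fix x :: real assume "x \<in> {0..}"
    then have "family_slope 0 1 x = x" by (auto simp: family_slope_0)
    then show "((\<lambda>x. x\<^sup>2 / 2) has_real_derivative family_slope 0 1 x) (at x within {0..})"
      by (auto intro!: derivative_eq_intros)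
  qed (use assms in \<open>auto simp: is_interval_1 lower_0\<close>)
  then show ?thesis by (simp add: lower_0)
qed

text \<open>Both sides are antiderivatives of the same slope, so k is minus the height at the base
  point. The case c = 1 is separate because its domain contains the endpoint on the axis.\<close>

lemma family_L_rotational:
  obtains k where "\<And>U. U \<in> height_domain c \<Longrightarrow> family_L 0 c U = height c U + k"
proof (cases "c = 1")
  case True
  then show ?thesis
    using that[of "-1/2"] family_L_paraboloid by (auto simp: height_domain_def height_def)
next
  case False
  then have dom: "height_domain c = {lower 0 c<..}"
    by (auto simp: height_domain_def lower_0)
  have "family_L 0 c U = height c U - height c (lower 0 c + 1)" if "U \<in> {lower 0 c<..}" for U
    unfolding family_L_def
  proof (rule antideriv_from_eq[where I = "{lower 0 c<..}"])
    fix x assume x: "x \<in> {lower 0 c<..}"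
    then have "x > 0" using lower_lessD(1)[of 0 c x] by simp
    then show "(height c has_real_derivative family_slope 0 c x) (at x within {lower 0 c<..})"
      using height_derivative[of c x] x by (auto simp: family_slope_0 intro: has_field_derivative_at_within)
  qed (use that in \<open>auto simp: is_interval_1\<close>)
  then show ?thesis using that[of "- height c (lower 0 c + 1)"] by (simp add: dom)
qed

lemma U_range_eq_height_domain: "U_range (lower 0 c) 0 c = height_domain c"
  by (auto simp: U_range_def height_domain_def lower_0)

lemma height_domain_nonneg: "U \<in> height_domain c \<Longrightarrow> U \<ge> 0"
  using lower_nonneg[of 0 c] by (auto simp: U_range_eq_height_domain[symmetric] U_range_def split: if_splits)

lemma family_profile_congruent:
  "congruent_sets (generating_curve (U_range (lower 0 c) 0 c) (family_R 0 c) (family_L 0 c))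
     (generating_curve (height_domain c) (\<lambda>U. U) (height c))"
proof -
  obtain k where k: "\<And>U. U \<in> height_domain c \<Longrightarrow> family_L 0 c U = height c U + k"
    using family_L_rotational by blast
  let ?f = "\<lambda>p. p - (vector [0, 0, k] :: real^3)"
  have "?f (vector [family_R 0 c U, 0, family_L 0 c U]) = vector [U, 0, height c U]" if "U \<in> height_domain c" for U
    using k[OF that] height_domain_nonneg[OF that] by (simp add: family_R_def vec_eq_iff forall_3)
  then have "?f ` generating_curve (height_domain c) (family_R 0 c) (family_L 0 c)
      = generating_curve (height_domain c) (\<lambda>U. U) (height c)"
    unfolding generating_curve_def image_image by (intro image_cong) auto
  then show ?thesis
    unfolding congruent_sets_def U_range_eq_height_domain by (intro exI[of _ ?f]) (auto simp: dist_norm)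
qed

lemma family_rotational:
  "rotational_surface (helicoidal_surface 0 (U_range (lower 0 c) 0 c) (family_R 0 c) (family_L 0 c))"
proof -
  have "continuous_on (height_domain c) (family_L 0 c)"
  proof (cases "c = 1")
    case True
    have "continuous_on {0..} (\<lambda>U::real. U\<^sup>2 / 2 - 1 / 2)" by (intro continuous_intros) auto
    then have "continuous_on {0..} (family_L 0 1)"
      by (subst continuous_on_cong[OF refl family_L_paraboloid]) auto
    then show ?thesis using True by (simp add: height_domain_def)
  next
    case False
    then have "height_domain c = {lower 0 c<..}" by (auto simp: height_domain_def lower_0)
    then show ?thesis
      using family_translator[of 0 c] by (auto simp: helicoidal_translator_def intro: smooth_on_imp_continuous_on)
  qed
  moreover have "continuous_on (height_domain c) (family_R 0 c)"
    unfolding family_R_def[abs_def] by (intro continuous_intros)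
  moreover have "is_interval (height_domain c)" "height_domain c \<noteq> {}"
    by (auto simp: height_domain_def is_interval_1 gt_ex)
  ultimately show ?thesis
    unfolding rotational_surface_def U_range_eq_height_domain by blast
qed

text \<open>Since R^2 + h^2 = U^2, the coordinate U is the continuous function sqrt (x^2 + y^2 +
  h^2) of the point, as the embedding criterion requires. The exceptional surface, closed up by its
  vertex, is identified with a full paraboloid.\<close>

lemma family_embedded:
  "K14_translator (helicoidal_surface h (U_range (lower h c) h c) (family_R h c) (family_L h c))"
proof (cases "h = 0 \<and> c = 1")
  case True
  have "helicoidal_surface 0 {0..} (family_R 0 1) (family_L 0 1) = {p. p $ 3 = ((p $ 1)\<^sup>2 + (p $ 2)\<^sup>2) / 2 + - 1 / 2}"
  proof (intro equalityI subsetI)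
    fix p assume "p \<in> helicoidal_surface 0 {0..} (family_R 0 1) (family_L 0 1)"
    then obtain U \<theta> where U: "U \<ge> 0" and p: "p = helicoidal_map 0 (family_R 0 1) (family_L 0 1) (U, \<theta>)"
      by (auto simp: helicoidal_surface_def)
    have "(U * cos \<theta>)\<^sup>2 + (U * sin \<theta>)\<^sup>2 = U\<^sup>2" by (simp add: power_mult_distrib distrib_left[symmetric])
    then show "p \<in> {p. p $ 3 = ((p $ 1)\<^sup>2 + (p $ 2)\<^sup>2) / 2 + - 1 / 2}"
      using U by (simp add: p helicoidal_map_def family_R_def family_L_paraboloid)
  next
    fix p :: "real^3" assume p: "p \<in> {p. p $ 3 = ((p $ 1)\<^sup>2 + (p $ 2)\<^sup>2) / 2 + - 1 / 2}"
    define U where "U = sqrt ((p $ 1)\<^sup>2 + (p $ 2)\<^sup>2)"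
    have U: "U \<ge> 0" "(p $ 1)\<^sup>2 + (p $ 2)\<^sup>2 = U\<^sup>2" by (auto simp: U_def)
    obtain \<theta> where "p $ 1 = U * cos \<theta>" "p $ 2 = U * sin \<theta>" by (rule circle_polar[OF U(2)])
    then have "p = helicoidal_map 0 (family_R 0 1) (family_L 0 1) (U, \<theta>)"
      using p U by (simp add: helicoidal_map_def family_R_def family_L_paraboloid vec_eq_iff forall_3)
    then show "p \<in> helicoidal_surface 0 {0..} (family_R 0 1) (family_L 0 1)"
      using U(1) by (auto simp: helicoidal_surface_def)
  qed
  then show ?thesis using True paraboloid_translator[of "-1/2"] by (simp add: U_range_def lower_0)
next
  case False
  have "K14_translator (helicoidal_surface h {lower h c<..} (family_R h c) (family_L h c))"
  proof (rule helicoidal_surface_embedded[OF family_translator])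
    show "continuous_on UNIV (\<lambda>p::real^3. sqrt ((p $ 1)\<^sup>2 + (p $ 2)\<^sup>2 + h\<^sup>2))" by (intro continuous_intros)
    fix U \<theta> assume "U \<in> {lower h c<..}"
    then have U: "U > 0" "U\<^sup>2 > h\<^sup>2" using lower_lessD(1,2)[of h c U] by auto
    then show "family_R h c U > 0" by (simp add: family_R_def)
    have "(family_R h c U * cos \<theta>)\<^sup>2 + (family_R h c U * sin \<theta>)\<^sup>2 = U\<^sup>2 - h\<^sup>2"
      using U(2) by (simp add: power_mult_distrib distrib_left[symmetric] family_R_def)
    then show "sqrt ((helicoidal_map h (family_R h c) (family_L h c) (U, \<theta>) $ 1)\<^sup>2 +
        (helicoidal_map h (family_R h c) (family_L h c) (U, \<theta>) $ 2)\<^sup>2 + h\<^sup>2) = U"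
      using U(1) by (simp add: helicoidal_map_def)
  qed
  moreover have "U_range (lower h c) h c = {lower h c<..}" using False by (auto simp: U_range_def)
  ultimately show ?thesis by simp
qed

theorem theorem1:
  shows
    "(\<forall>\<mu> I R L. helicoidal_translator \<mu> I R L \<longrightarrow>
        (\<exists>Rf Lf. isometric_translator_family \<mu> I R L {-\<bar>\<mu>\<bar>..\<bar>\<mu>\<bar>} Rf Lf) \<and>
        (\<forall>a b. a < b \<and> {a..b} \<subseteq> I \<longrightarrow>
           (\<exists>\<epsilon>>0. \<exists>Rf Lf. isometric_translator_family \<mu> {a<..<b} R L
                             {-(\<bar>\<mu>\<bar> + \<epsilon>)<..<\<bar>\<mu>\<bar> + \<epsilon>} Rf Lf))) \<and>
     (\<forall>r>0. rotational_surface (cylinder 0 0 r) \<and> (\<forall>x y. K14_translator (cylinder x y r))) \<and>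
     (\<exists>(a :: real \<Rightarrow> real \<Rightarrow> real) (R :: real \<Rightarrow> real \<Rightarrow> real \<Rightarrow> real) (L :: real \<Rightarrow> real \<Rightarrow> real \<Rightarrow> real)
         (H :: real \<Rightarrow> real \<Rightarrow> (real ^ 3) set).
        (\<forall>h c. H h c = helicoidal_surface h (U_range (a h c) h c) (R h c) (L h c) \<and>
               K14_translator (H h c) \<and>
               helicoidal_translator h {a h c<..} (R h c) (L h c)) \<and>
        continuous_on UNIV (\<lambda>(h, c). a h c) \<and>
        continuous_on {(h, c, U). a h c < U} (\<lambda>(h, c, U). (R h c U, L h c U)) \<and>
        (\<forall>c. rotational_surface (H 0 c) \<and>
             (\<forall>T. screw_motion 0 T ` H 0 c = H 0 c) \<and>
             congruent_sets (generating_curve (U_range (a 0 c) 0 c) (R 0 c) (L 0 c))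
                            (generating_curve (height_domain c) (\<lambda>U. U) (height c))) \<and>
        (\<forall>h c. (\<forall>T. screw_motion h T ` H h c = H h c) \<and>
               (\<exists>\<phi> \<sigma>. diffeo ({a h c<..} \<times> UNIV) ({a h c<..} \<times> UNIV) \<phi> \<and>
                   (\<forall>p. fst (\<phi> p) = fst p) \<and>
                   \<sigma> \<in> {1, -1} \<and>
                   (let X = helicoidal_map h (R h c) (L h c) \<circ> \<phi> in
                      \<forall>U t. U > a h c \<longrightarrow>
                        ff_E X (U, t) = U\<^sup>2 + c \<and> ff_F X (U, t) = 0 \<and> ff_G X (U, t) = U\<^sup>2 \<and>
                        angle_function X (U, t) = \<sigma> * (1 / sqrt (U\<^sup>2 + c)))) \<and>
               a 0 c \<le> a h c \<and>
               isometric_patches ({a h c<..} \<times> UNIV) (helicoidal_map h (R h c) (L h c))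
                                 ({a h c<..} \<times> UNIV) (helicoidal_map 0 (R 0 c) (L 0 c))))"
proof -
  have A: "\<forall>\<mu> I R L. helicoidal_translator \<mu> I R L \<longrightarrow>
        (\<exists>Rf Lf. isometric_translator_family \<mu> I R L {-\<bar>\<mu>\<bar>..\<bar>\<mu>\<bar>} Rf Lf) \<and>
        (\<forall>a b. a < b \<and> {a..b} \<subseteq> I \<longrightarrow>
           (\<exists>\<epsilon>>0. \<exists>Rf Lf. isometric_translator_family \<mu> {a<..<b} R L
                             {-(\<bar>\<mu>\<bar> + \<epsilon>)<..<\<bar>\<mu>\<bar> + \<epsilon>} Rf Lf))"
    by (intro allI impI conjI; (elim conjE)?) (assumption | rule deformation_closed deformation_open)+
  have B: "\<forall>r>0. rotational_surface (cylinder 0 0 r) \<and> (\<forall>x y. K14_translator (cylinder x y r))"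
    by (intro allI impI conjI cylinder_translator)
  define H where "H h c = helicoidal_surface h (U_range (lower h c) h c) (family_R h c) (family_L h c)" for h c
  have C: "\<exists>\<phi> \<sigma>. diffeo ({lower h c<..} \<times> UNIV) ({lower h c<..} \<times> UNIV) \<phi> \<and>
                   (\<forall>p. fst (\<phi> p) = fst p) \<and>
                   \<sigma> \<in> {1, -1} \<and>
                   (let X = helicoidal_map h (family_R h c) (family_L h c) \<circ> \<phi> in
                      \<forall>U t. U > lower h c \<longrightarrow>
                        ff_E X (U, t) = U\<^sup>2 + c \<and> ff_F X (U, t) = 0 \<and> ff_G X (U, t) = U\<^sup>2 \<and>
                        angle_function X (U, t) = \<sigma> * (1 / sqrt (U\<^sup>2 + c)))" for h c :: real
  proof -
    obtain \<phi> where \<phi>: "diffeo ({lower h c<..} \<times> UNIV) ({lower h c<..} \<times> UNIV) \<phi>" "\<forall>p. fst (\<phi> p) = fst p"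
      "let X = helicoidal_map h (family_R h c) (family_L h c) \<circ> \<phi> in
        \<forall>U t. U > lower h c \<longrightarrow>
          ff_E X (U, t) = U\<^sup>2 + c \<and> ff_F X (U, t) = 0 \<and> ff_G X (U, t) = U\<^sup>2 \<and>
          angle_function X (U, t) = 1 / sqrt (U\<^sup>2 + c)"
      using family_coordinates[of h c] by (elim exE conjE)
    then show ?thesis by (intro exI[of _ \<phi>] exI[of _ 1]) simp
  qed
  show ?thesis
  proof (intro conjI)
    show "\<exists>(a :: real \<Rightarrow> real \<Rightarrow> real) (R :: real \<Rightarrow> real \<Rightarrow> real \<Rightarrow> real) (L :: real \<Rightarrow> real \<Rightarrow> real \<Rightarrow> real)
         (H :: real \<Rightarrow> real \<Rightarrow> (real ^ 3) set).
        (\<forall>h c. H h c = helicoidal_surface h (U_range (a h c) h c) (R h c) (L h c) \<and>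
               K14_translator (H h c) \<and>
               helicoidal_translator h {a h c<..} (R h c) (L h c)) \<and>
        continuous_on UNIV (\<lambda>(h, c). a h c) \<and>
        continuous_on {(h, c, U). a h c < U} (\<lambda>(h, c, U). (R h c U, L h c U)) \<and>
        (\<forall>c. rotational_surface (H 0 c) \<and>
             (\<forall>T. screw_motion 0 T ` H 0 c = H 0 c) \<and>
             congruent_sets (generating_curve (U_range (a 0 c) 0 c) (R 0 c) (L 0 c))
                            (generating_curve (height_domain c) (\<lambda>U. U) (height c))) \<and>
        (\<forall>h c. (\<forall>T. screw_motion h T ` H h c = H h c) \<and>
               (\<exists>\<phi> \<sigma>. diffeo ({a h c<..} \<times> UNIV) ({a h c<..} \<times> UNIV) \<phi> \<and>
                   (\<forall>p. fst (\<phi> p) = fst p) \<and>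
                   \<sigma> \<in> {1, -1} \<and>
                   (let X = helicoidal_map h (R h c) (L h c) \<circ> \<phi> in
                      \<forall>U t. U > a h c \<longrightarrow>
                        ff_E X (U, t) = U\<^sup>2 + c \<and> ff_F X (U, t) = 0 \<and> ff_G X (U, t) = U\<^sup>2 \<and>
                        angle_function X (U, t) = \<sigma> * (1 / sqrt (U\<^sup>2 + c)))) \<and>
               a 0 c \<le> a h c \<and>
               isometric_patches ({a h c<..} \<times> UNIV) (helicoidal_map h (R h c) (L h c))
                                 ({a h c<..} \<times> UNIV) (helicoidal_map 0 (R 0 c) (L 0 c)))"
      by (intro exI[of _ lower] exI[of _ family_R] exI[of _ family_L] exI[of _ H] conjI allI)
        (simp_all only: H_def refl family_embedded family_translator continuous_on_lower continuous_on_family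
          family_rotational screw_motion_helicoidal_surface family_profile_congruent C lower_ge_lower_0
          family_isometric)
  qed (rule A B)+
qed

end
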